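(* Let $N>2$, let $P=(P_1,P_2):\mathbb{R}^N\to\mathbb{R}^2$ be a polynomial map, and put $V_\epsilon=\{z\in\mathbb{R}^N: P_1(z)=\epsilon,\ P_2(z)=0\}$. Assume that $V_\epsilon$ is a manifold of codimension $2$ for every sufficiently small $\epsilon\ne0$. Let $\mathcal V_0$ be a stratification of $V_0$ by semialgebraic strata with the following property (T): whenever a $C^2$ map $G:\mathbb{R}^2\to\mathbb{R}^N$ is transversal at a point $a$ to the stratified set $(V_0,\mathcal V_0)$, there are a neighborhood $U$ of $a$ and $\epsilon_0>0$ such that $G|_U$ is transversal to $V_\epsilon$ for all $0<|\epsilon|<\epsilon_0$. Let $F:\mathbb{R}^2\to\mathbb{R}^N$ be a $C^k$ map, $k>2$, transversal to $(V_0,\mathcal V_0)$, let $a\in\mathbb{R}^2$, and let $L_{F,a}(x)=F(a)+dF(a)(x-a)$ be the linearization of $F$ at $a$. Then for every sufficiently small $r>0$ and all sufficiently small $\epsilon\neq 0$ (depending on $r$), $$\#\{x\in B_r(a):\ (P_1,P_2)\circ F(x)=(\epsilon,0)\}=\#\{x\in B_r(a):\ (P_1,P_2)\circ L_{F,a}(x)=(\epsilon,0)\},$$ where $B_r(a)$ is the ball of radius $r$ centered at $a$.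
   Context: A stratification of a locally closed subset $V$ of a manifold is a locally finite decomposition of $V$ into a disjoint union of smooth submanifolds (strata) such that the closure of each stratum consists (within $V$) of itself and a union of other strata of strictly smaller dimension, and Whitney's condition (b) holds for each pair of adjacent strata. A map $G$ is transversal to a stratified set $(V,\mathcal V)$ (at a point) if it is transversal to each stratum of $\mathcal V$ (at that point). *)

theory Defs
  imports "HOL-Analysis.Analysis"
begin

text \<open>\<open>Ck_on k S f\<close> is meant for open \<open>S\<close> only: it uses derivatives within the whole space.\<close>

primrec Ck_on ::
    "nat \<Rightarrow> 'a::euclidean_space set \<Rightarrow> ('a \<Rightarrow> 'b::euclidean_space) \<Rightarrow> bool" where
  "Ck_on 0 S f \<longleftrightarrow> continuous_on S f"
| "Ck_on (Suc k) S f \<longleftrightarrow>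
     (\<forall>x\<in>S. f differentiable (at x)) \<and>
     (\<forall>v. Ck_on k S (\<lambda>x. frechet_derivative f (at x) v))"

definition smooth_on ::
    "'a::euclidean_space set \<Rightarrow> ('a \<Rightarrow> 'b::euclidean_space) \<Rightarrow> bool" where
  "smooth_on S f \<longleftrightarrow> (\<forall>k. Ck_on k S f)"

text \<open>Embedded smooth submanifolds of dimension \<open>d\<close>, by flattening charts of the ambient
  space. The empty set is a submanifold of every dimension.\<close>

definition smooth_submanifold :: "nat \<Rightarrow> 'a::euclidean_space set \<Rightarrow> bool" where
  "smooth_submanifold d M \<longleftrightarrow>
     (\<forall>p\<in>M. \<exists>U W \<phi> \<psi> L.
        open U \<and> p \<in> U \<and> open (W :: 'a set) \<and>
        homeomorphism U W \<phi> \<psi> \<and> smooth_on U \<phi> \<and> smooth_on W \<psi> \<and>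
        subspace L \<and> dim L = d \<and> \<phi> ` (M \<inter> U) = W \<inter> L)"

definition tangent_space :: "'a::euclidean_space set \<Rightarrow> 'a \<Rightarrow> 'a set" where
  "tangent_space M p =
     {v. \<exists>(\<gamma> :: real \<Rightarrow> 'a) \<delta>. \<delta> > 0 \<and> smooth_on {-\<delta><..<\<delta>} \<gamma> \<and>
           \<gamma> ` {-\<delta><..<\<delta>} \<subseteq> M \<and> \<gamma> 0 = p \<and> (\<gamma> has_vector_derivative v) (at 0)}"

definition transversal_at ::
    "('a::euclidean_space \<Rightarrow> 'b::euclidean_space) \<Rightarrow> 'b set \<Rightarrow> 'a \<Rightarrow> bool" where
  "transversal_at f M x \<longleftrightarrow>
     (f x \<in> M \<longrightarrow>
      {u + w |u w. u \<in> range (frechet_derivative f (at x)) \<and> w \<in> tangent_space M (f x)} = UNIV)"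

definition strat_transversal_at ::
    "('a::euclidean_space \<Rightarrow> 'b::euclidean_space) \<Rightarrow> 'b set set \<Rightarrow> 'a \<Rightarrow> bool" where
  "strat_transversal_at f \<V> x \<longleftrightarrow> (\<forall>S\<in>\<V>. transversal_at f S x)"

inductive semialgebraic :: "'a::euclidean_space set \<Rightarrow> bool" where
  zero: "real_polynomial_function p \<Longrightarrow> semialgebraic {x. p x = 0}"
| pos: "real_polynomial_function p \<Longrightarrow> semialgebraic {x. p x > 0}"
| compl: "semialgebraic A \<Longrightarrow> semialgebraic (- A)"
| union: "semialgebraic A \<Longrightarrow> semialgebraic B \<Longrightarrow> semialgebraic (A \<union> B)"
| inter: "semialgebraic A \<Longrightarrow> semialgebraic B \<Longrightarrow> semialgebraic (A \<inter> B)"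

text \<open>Convergence in the Grassmannian: a subspace is identified with the orthogonal projection
  onto it, which is what \<open>closest_point\<close> is for a subspace.\<close>

definition subspaces_tendsto :: "(nat \<Rightarrow> 'a::euclidean_space set) \<Rightarrow> 'a set \<Rightarrow> bool" where
  "subspaces_tendsto T \<tau> \<longleftrightarrow>
     subspace \<tau> \<and> (\<forall>v. (\<lambda>n. closest_point (T n) v) \<longlonglongrightarrow> closest_point \<tau> v)"

text \<open>Whitney's condition (b) for the pair \<open>(R, S)\<close>, where \<open>S\<close> lies in the closure of \<open>R\<close>.\<close>

definition whitney_b :: "'a::euclidean_space set \<Rightarrow> 'a set \<Rightarrow> bool" where
  "whitney_b R S \<longleftrightarrow>
     (\<forall>p\<in>S. \<forall>x y \<tau> \<l>.
        (\<forall>n. x n \<in> R) \<and> (\<forall>n. y n \<in> S) \<and> (\<forall>n. x n \<noteq> y n) \<and> x \<longlonglongrightarrow> p \<and> y \<longlonglongrightarrow> p \<and>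
        subspaces_tendsto (\<lambda>n. tangent_space R (x n)) \<tau> \<and>
        subspaces_tendsto (\<lambda>n. span {x n - y n}) \<l>
        \<longrightarrow> \<l> \<subseteq> \<tau>)"

text \<open>The function \<open>dm\<close> gives the dimensions of the strata; it is determined by \<open>\<V>\<close>,
  because the strata are nonempty.\<close>

definition stratification :: "'a::euclidean_space set \<Rightarrow> 'a set set \<Rightarrow> bool" where
  "stratification V \<V> \<longleftrightarrow>
     partition_on V \<V> \<and>
     locally_finite_in (top_of_set V) \<V> \<and>
     (\<exists>dm. (\<forall>S\<in>\<V>. smooth_submanifold (dm S) S) \<and>
           (\<forall>S\<in>\<V>. \<exists>\<C>\<subseteq>\<V>. closure S \<inter> V = S \<union> \<Union>\<C> \<and> (\<forall>R\<in>\<C>. dm R < dm S))) \<and>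
     (\<forall>R\<in>\<V>. \<forall>S\<in>\<V>. R \<noteq> S \<and> S \<subseteq> closure R \<longrightarrow> whitney_b R S)"

definition linearization ::
    "('a::euclidean_space \<Rightarrow> 'b::euclidean_space) \<Rightarrow> 'a \<Rightarrow> 'a \<Rightarrow> 'b" where
  "linearization F a x = F a + frechet_derivative F (at a) (x - a)"

end

theory Submission
  imports Defs
begin

text \<open>
  Let \<open>F\<^sub>t = F + t (L - F)\<close> with \<open>L\<close> the linearization. Property (T) speaks about one map at a
  time, but it yields uniform statements: a sequence of counterexamples at points converging fast to
  \<open>a\<close> can be built into a single \<open>C\<^sup>2\<close> map, because 1-jets may be prescribed along such a sequence.
  In this way, \<open>F\<^sub>t\<close> is transversal to \<open>V\<^sub>\<epsilon>\<close> near \<open>a\<close>, uniformly in \<open>t\<close> and small \<open>\<epsilon>\<close>, and the limit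
  points of \<open>V\<^sub>\<epsilon>\<close> as \<open>\<epsilon> \<rightarrow> 0\<close> miss all strata of codimension less than 2. Hence near \<open>F(a)\<close> these limit
  points lie in the stratum through \<open>F(a)\<close>, which has codimension exactly 2 and is transversal to every \<open>F\<^sub>t\<close>
  at \<open>a\<close>, so \<open>F\<^sub>t\<close> avoids them on a punctured neighbourhood of \<open>a\<close>. For small \<open>\<epsilon>\<close> the solutions of \<open>F\<^sub>t(x) \<in> V\<^sub>\<epsilon>\<close>
  therefore stay off the sphere of radius \<open>r\<close> and, by transversality, continue uniquely in \<open>t\<close>: their
  number does not change from \<open>t = 0\<close> to \<open>t = 1\<close>.
\<close>

subsection \<open>Submanifolds and transversal solutions\<close>

text \<open>Why interpolation stays in class C2: a jet placed at distance r from \<open>a\<close> is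
  cut off on a shell of width comparable to r, so each derivative of the cutoff costs a factor 1/r.
  Jets whose value is of size r^2, first derivative of size r and second derivative bounded survive
  this without loss, and an extra factor 2^-n makes the sum converge. Along the homotopy these sizes
  are Taylor's theorem: two of its members differ by (t - s) (L - F), where L - F is quadratic at
  \<open>a\<close>, and fast convergence of the times supplies 2^-n. For limit points only values
  are prescribed, so the approximating points can simply be chosen close enough. The obstacle in the
  count is the order of the quantifiers: r is fixed before \<epsilon>, while the radii of unique
  continuation depend on \<epsilon> and may shrink with it. Hence solutions for different \<epsilon>
  are never compared. The radius comes from the stratum of V_0 through F(a), only the sphere has to
  be controlled uniformly, and for each single \<epsilon> the count is carried from t = 0 to t = 1
  by connectedness of the interval.\<close>

lemma Ck_on_subset: "Ck_on k S f \<Longrightarrow> T \<subseteq> S \<Longrightarrow> Ck_on k T f"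
  by (induction k arbitrary: f) (auto intro: continuous_on_subset)

lemma Ck_on_cong:
  assumes "open S" and "\<And>x. x \<in> S \<Longrightarrow> f x = g x"
  shows "Ck_on k S f \<longleftrightarrow> Ck_on k S g"
  using assms(2)
proof (induction k arbitrary: f g)
  case 0
  then show ?case by (auto cong: continuous_on_cong)
next
  case (Suc k)
  have d: "(f has_derivative D) (at x) \<longleftrightarrow> (g has_derivative D) (at x)" if "x \<in> S" for x D
    using has_derivative_transform_within_open[of f D x UNIV S g]
      has_derivative_transform_within_open[of g D x UNIV S f] Suc.prems that assms(1) by auto
  have "frechet_derivative f (at x) = frechet_derivative g (at x)" if "x \<in> S" for x
    unfolding frechet_derivative_def using d[OF that] by simp
  then have "Ck_on k S (\<lambda>x. frechet_derivative f (at x) v)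
      \<longleftrightarrow> Ck_on k S (\<lambda>x. frechet_derivative g (at x) v)" for v
    by (intro Suc.IH) simp
  then show ?case using d by (auto simp: differentiable_def)
qed

lemma Ck_on_SucD: "Ck_on (Suc k) S f \<Longrightarrow> Ck_on k S f"
proof (induction k arbitrary: f)
  case 0
  then show ?case
    by (auto simp: intro!: continuous_at_imp_continuous_on differentiable_imp_continuous_within)
next
  case (Suc k)
  then show ?case by (metis Ck_on.simps(2))
qed

lemma Ck_on_mono: "Ck_on n S f \<Longrightarrow> m \<le> n \<Longrightarrow> Ck_on m S f"
  by (induction n) (auto simp: le_Suc_eq simp del: Ck_on.simps dest: Ck_on_SucD)

text \<open>The derivative of the restriction in direction \<open>v\<close> is a derivative of
  \<open>f\<close> in the fixed direction \<open>v *\<^sub>R l\<close>, so the induction closes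
  without a product rule. Lines suffice because the curves that realise tangent vectors are straight
  in a chart.\<close>

lemma Ck_on_comp_line:
  fixes q l :: "'a::euclidean_space"
  assumes "open S" and "Ck_on k S f"
  shows "Ck_on k {s. q + s *\<^sub>R l \<in> S} (\<lambda>s. f (q + s *\<^sub>R l))"
  using assms(2)
proof (induction k arbitrary: f)
  case 0
  then show ?case
    by (auto intro!: continuous_on_compose2[of S f] continuous_intros)
next
  case (Suc k)
  let ?T = "{s. q + s *\<^sub>R l \<in> S}"
  have "open ((\<lambda>s. q + s *\<^sub>R l) -` S)"
    by (intro open_vimage assms(1) continuous_intros)
  then have "open ?T" by (simp add: vimage_def)
  have D: "((\<lambda>s. f (q + s *\<^sub>R l)) has_derivative
      (\<lambda>t. frechet_derivative f (at (q + s *\<^sub>R l)) (t *\<^sub>R l))) (at s)" if "s \<in> ?T" for s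
  proof -
    have "(f has_derivative frechet_derivative f (at (q + s *\<^sub>R l))) (at (q + s *\<^sub>R l))"
      using that Suc.prems by (auto simp: frechet_derivative_works)
    moreover have "((\<lambda>s. q + s *\<^sub>R l) has_derivative (\<lambda>t. t *\<^sub>R l)) (at s)"
      by (auto intro!: derivative_eq_intros)
    ultimately show ?thesis by (rule has_derivative_compose[rotated])
  qed
  have "Ck_on k ?T (\<lambda>s. frechet_derivative (\<lambda>s. f (q + s *\<^sub>R l)) (at s) v)" for v
  proof -
    have "Ck_on k ?T (\<lambda>s. frechet_derivative f (at (q + s *\<^sub>R l)) (v *\<^sub>R l))"
      using Suc.IH[of "\<lambda>x. frechet_derivative f (at x) (v *\<^sub>R l)"] Suc.prems by auto
    moreover have "frechet_derivative (\<lambda>s. f (q + s *\<^sub>R l)) (at s) v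
        = frechet_derivative f (at (q + s *\<^sub>R l)) (v *\<^sub>R l)" if "s \<in> ?T" for s
      using fun_cong[OF frechet_derivative_at[OF D[OF that]], of v] by simp
    ultimately show ?thesis
      using Ck_on_cong[OF \<open>open ?T\<close>] by (metis (no_types, lifting))
  qed
  then show ?case using D by (auto simp: differentiable_def)
qed

section \<open>Charts and tangent spaces\<close>

text \<open>Translates the tangent space, defined by curves, into linear algebra in a chart. A curve
  in \<open>M\<close> has difference quotients in \<open>L\<close> after applying
  \<open>\<phi>\<close>, and \<open>L\<close> is closed, so its velocity is mapped into
  \<open>L\<close>; conversely a line in \<open>L\<close> is pulled back by \<open>\<psi>\<close>.
  The derivative of \<open>\<phi>\<close> at \<open>p\<close> is invertible because that of
  \<open>\<psi>\<close> is a left inverse.\<close>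

lemma smooth_submanifold_chart:
  fixes M :: "'a::euclidean_space set"
  assumes "smooth_submanifold d M" and "p \<in> M"
  obtains U and \<phi> :: "'a \<Rightarrow> 'a" and \<phi>' L where "open U" "p \<in> U" "subspace L" "dim L = d"
    "\<And>y. y \<in> U \<Longrightarrow> (\<phi> has_derivative \<phi>' y) (at y)" "\<And>v. continuous_on U (\<lambda>y. \<phi>' y v)"
    "bij (\<phi>' p)" "\<And>y. y \<in> U \<Longrightarrow> y \<in> M \<longleftrightarrow> \<phi> y \<in> L"
    "tangent_space M p = {v. \<phi>' p v \<in> L}"
proof -
  obtain U W \<phi> \<psi> L where U: "open U" "p \<in> U" "open (W :: 'a set)" "homeomorphism U W \<phi> \<psi>"
    and sm: "smooth_on U \<phi>" "smooth_on W \<psi>"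
    and L: "subspace L" "dim L = d" "\<phi> ` (M \<inter> U) = W \<inter> L"
    using assms unfolding smooth_submanifold_def by metis
  define \<phi>' where "\<phi>' y = frechet_derivative \<phi> (at y)" for y
  have "Ck_on (Suc 0) U \<phi>" "Ck_on (Suc 0) W \<psi>"
    using sm unfolding smooth_on_def by blast+
  then have d\<phi>: "\<And>y. y \<in> U \<Longrightarrow> (\<phi> has_derivative \<phi>' y) (at y)"
    and c\<phi>: "\<And>v. continuous_on U (\<lambda>y. \<phi>' y v)"
    and d\<psi>: "\<And>y. y \<in> W \<Longrightarrow> (\<psi> has_derivative frechet_derivative \<psi> (at y)) (at y)"
    by (auto simp: \<phi>'_def frechet_derivative_works)
  have \<psi>\<phi>: "\<psi> (\<phi> y) = y" "\<phi> y \<in> W" if "y \<in> U" for y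
    using U(4) that by (auto simp: homeomorphism_def)
  have \<phi>\<psi>: "\<phi> (\<psi> y) = y" "\<psi> y \<in> U" if "y \<in> W" for y
    using U(4) that by (auto simp: homeomorphism_def)
  define \<psi>' where "\<psi>' = frechet_derivative \<psi> (at (\<phi> p))"
  have "((\<lambda>y. \<psi> (\<phi> y)) has_derivative (\<lambda>v. \<psi>' (\<phi>' p v))) (at p)"
    unfolding \<psi>'_def using has_derivative_compose[OF d\<phi>[OF U(2)] d\<psi>[OF \<psi>\<phi>(2)[OF U(2)]]] .
  then have "((\<lambda>y. y) has_derivative (\<lambda>v. \<psi>' (\<phi>' p v))) (at p)"
    by (rule has_derivative_transform_within_open[OF _ U(1,2)]) (simp add: \<psi>\<phi>)
  from has_derivative_unique[OF this has_derivative_ident]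
  have inv: "\<psi>' (\<phi>' p v) = v" for v by (auto dest: fun_cong)
  have lin: "linear (\<phi>' p)" using d\<phi>[OF U(2)] has_derivative_linear by blast
  have "inj (\<phi>' p)" by (metis inv injI)
  then have bij: "bij (\<phi>' p)"
    using linear_injective_imp_surjective[OF lin] by (auto simp: bij_def)
  have mem: "y \<in> M \<longleftrightarrow> \<phi> y \<in> L" if "y \<in> U" for y
  proof
    assume "y \<in> M" then show "\<phi> y \<in> L" using L(3) that by blast
  next
    assume "\<phi> y \<in> L"
    then have "\<phi> y \<in> \<phi> ` (M \<inter> U)" using L(3) \<psi>\<phi>(2)[OF that] by blast
    then show "y \<in> M" using \<psi>\<phi>(1) that by (metis (no_types, lifting) Int_iff imageE)
  qed
  have "tangent_space M p = {v. \<phi>' p v \<in> L}"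
  proof (intro equalityI subsetI)
    fix v assume "v \<in> tangent_space M p"
    then obtain \<gamma> \<delta> where g: "\<delta> > (0::real)" "\<gamma> ` {-\<delta><..<\<delta>} \<subseteq> M" "\<gamma> 0 = p"
      "(\<gamma> has_vector_derivative v) (at 0)"
      unfolding tangent_space_def by blast
    have "((\<lambda>s. \<phi> (\<gamma> s)) has_derivative (\<lambda>t. \<phi>' p (t *\<^sub>R v))) (at 0)"
      using has_derivative_compose[OF g(4)[unfolded has_vector_derivative_def], of \<phi> "\<phi>' p"]
        d\<phi>[OF U(2)] g(3) by simp
    then have "((\<lambda>s. \<phi> (\<gamma> s)) has_vector_derivative \<phi>' p v) (at 0)"
      by (simp add: has_vector_derivative_def linear_scale[OF lin])
    then have "(\<lambda>s. norm (\<phi> (\<gamma> s) - \<phi> p - s *\<^sub>R \<phi>' p v) / norm s) \<midarrow>0\<rightarrow> 0"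
      by (simp add: has_vector_derivative_def has_derivative_at g(3))
    moreover have "norm (\<phi> (\<gamma> s) - \<phi> p - s *\<^sub>R \<phi>' p v) / norm s
        = norm ((1 / s) *\<^sub>R (\<phi> (\<gamma> s) - \<phi> p) - \<phi>' p v)" if "s \<noteq> 0" for s
    proof -
      have "(1 / s) *\<^sub>R (\<phi> (\<gamma> s) - \<phi> p) - \<phi>' p v = (1 / s) *\<^sub>R (\<phi> (\<gamma> s) - \<phi> p - s *\<^sub>R \<phi>' p v)"
        using that by (simp add: algebra_simps)
      then show ?thesis by simp
    qed
    ultimately have "(\<lambda>s. norm ((1 / s) *\<^sub>R (\<phi> (\<gamma> s) - \<phi> p) - \<phi>' p v)) \<midarrow>0\<rightarrow> 0"
      using LIM_cong[of 0 0] by (smt (verit, best))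
    then have lim: "((\<lambda>s. (1 / s) *\<^sub>R (\<phi> (\<gamma> s) - \<phi> p)) \<longlongrightarrow> \<phi>' p v) (at 0)"
      by (metis LIM_zero_cancel tendsto_norm_zero_iff)
    have "\<gamma> \<midarrow>0\<rightarrow> p"
      using has_vector_derivative_continuous[OF g(4)] g(3) by (simp add: isCont_def)
    then have "\<forall>\<^sub>F s in at 0. \<gamma> s \<in> U" using U(1,2) by (rule topological_tendstoD)
    moreover have "\<forall>\<^sub>F s in at 0. s \<in> {-\<delta><..<\<delta>}"
      by (rule eventually_at_in_open') (use g(1) in auto)
    ultimately have "\<forall>\<^sub>F s in at 0. (1 / s) *\<^sub>R (\<phi> (\<gamma> s) - \<phi> p) \<in> L"
    proof eventually_elim
      case (elim s)
      then have "\<phi> (\<gamma> s) \<in> L" using mem g(2) by blast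
      moreover have "\<phi> p \<in> L" using mem U(2) assms(2) by blast
      ultimately show ?case using L(1) by (simp add: subspace_diff subspace_scale)
    qed
    then show "v \<in> {v. \<phi>' p v \<in> L}"
      using Lim_in_closed_set[OF closed_subspace[OF L(1)] _ _ lim] by simp
  next
    fix v assume v: "v \<in> {v. \<phi>' p v \<in> L}"
    let ?l = "\<phi>' p v" and ?\<gamma> = "\<lambda>s. \<psi> (\<phi> p + s *\<^sub>R \<phi>' p v)"
    let ?T = "{s. \<phi> p + s *\<^sub>R ?l \<in> W}"
    have "open ((\<lambda>s. \<phi> p + s *\<^sub>R ?l) -` W)"
      by (intro open_vimage U(3) continuous_intros)
    then have "open ?T" by (simp add: vimage_def)
    moreover have "0 \<in> ?T" using \<psi>\<phi>(2)[OF U(2)] by simp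
    ultimately obtain \<delta> where \<delta>: "\<delta> > 0" "ball 0 \<delta> \<subseteq> ?T" by (meson open_contains_ball)
    then have sub: "{-\<delta><..<\<delta>} \<subseteq> ?T" by (simp add: ball_eq_greaterThanLessThan)
    have "smooth_on {-\<delta><..<\<delta>} ?\<gamma>"
      unfolding smooth_on_def
      using Ck_on_subset[OF Ck_on_comp_line[OF U(3)] sub] sm(2)[unfolded smooth_on_def] by blast
    moreover have "?\<gamma> s \<in> M" if "s \<in> {-\<delta><..<\<delta>}" for s
    proof -
      have s: "\<phi> p + s *\<^sub>R ?l \<in> W" using sub that by blast
      have "\<phi> p \<in> L" using mem U(2) assms(2) by blast
      then have "\<phi> p + s *\<^sub>R ?l \<in> L" using v L(1) by (simp add: subspace_add subspace_scale)
      then show ?thesis using mem \<phi>\<psi>[OF s] by simp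
    qed
    moreover have "(?\<gamma> has_vector_derivative v) (at 0)"
    proof -
      have "(\<psi> has_derivative \<psi>') (at (\<phi> p + 0 *\<^sub>R ?l))"
        using d\<psi>[OF \<psi>\<phi>(2)[OF U(2)]] by (simp add: \<psi>'_def)
      moreover have "linear \<psi>'"
        using d\<psi>[OF \<psi>\<phi>(2)[OF U(2)]] has_derivative_linear \<psi>'_def by blast
      moreover have "((\<lambda>s. \<phi> p + s *\<^sub>R ?l) has_derivative (\<lambda>s. s *\<^sub>R ?l)) (at 0)"
        by (auto intro!: derivative_eq_intros)
      ultimately show ?thesis
        using has_derivative_compose[of "\<lambda>s. \<phi> p + s *\<^sub>R ?l" "\<lambda>s. s *\<^sub>R ?l" 0 UNIV \<psi> \<psi>']
        unfolding has_vector_derivative_def by (simp add: linear_scale inv)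
    qed
    ultimately show "v \<in> tangent_space M p"
      unfolding tangent_space_def using \<delta>(1) \<psi>\<phi>(1)[OF U(2)]
      by (intro CollectI exI[of _ ?\<gamma>] exI[of _ \<delta>]) auto
  qed
  with U L d\<phi> c\<phi> bij mem show thesis by (intro that[of U L \<phi> \<phi>'])
qed

lemma tangent_space_dim:
  fixes M :: "'a::euclidean_space set"
  assumes "smooth_submanifold d M" and "p \<in> M"
  shows "subspace (tangent_space M p)" and "dim (tangent_space M p) = d"
proof -
  obtain L and \<phi>' :: "'a \<Rightarrow> 'a \<Rightarrow> 'a" where c: "linear (\<phi>' p)" "subspace L" "dim L = d"
    "bij (\<phi>' p)" "tangent_space M p = {v. \<phi>' p v \<in> L}"
  proof (rule smooth_submanifold_chart[OF assms])
    fix U L and \<phi> :: "'a \<Rightarrow> 'a" and \<phi>'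
    assume "p \<in> U" "subspace L" "dim L = d" "bij (\<phi>' p)" "tangent_space M p = {v. \<phi>' p v \<in> L}"
      and "\<And>y. y \<in> U \<Longrightarrow> (\<phi> has_derivative \<phi>' y) (at y)"
    then show thesis using that has_derivative_linear by blast
  qed
  have lin: "linear (\<phi>' p)" by (rule c(1))
  have vim: "tangent_space M p = \<phi>' p -` L" using c by auto
  show sub: "subspace (tangent_space M p)"
    unfolding vim using linear_subspace_vimage[OF lin c(2)] .
  have "\<phi>' p ` tangent_space M p = L" 
    unfolding vim using c(4) by (simp add: bij_def surj_image_vimage_eq)
  moreover have "dim (\<phi>' p ` tangent_space M p) = dim (tangent_space M p)"
    using c(4) lin by (intro dim_image_eq) (auto simp: bij_def intro: inj_on_subset)
  ultimately show "dim (tangent_space M p) = d" using c(3) by simp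
qed

text \<open>The tube lemma with a filter as the second factor: a finite subcover of \<open>K\<close>
  leaves only finitely many conditions on the filter side. It provides the uniformity over the times
  in [0,1], over times and sphere together, and over the part of the ball away from the
  solutions.\<close>

lemma eventually_compact:
  assumes "compact K" and "\<And>k. k \<in> K \<Longrightarrow> \<forall>\<^sub>F p in nhds k \<times>\<^sub>F G. Q p"
  shows "\<forall>\<^sub>F y in G. \<forall>k\<in>K. Q (k, y)"
proof -
  have "\<exists>A B. open A \<and> k \<in> A \<and> eventually B G \<and> (\<forall>x y. x \<in> A \<longrightarrow> B y \<longrightarrow> Q (x, y))"
    if "k \<in> K" for k
    using assms(2)[OF that] unfolding eventually_prod_filter eventually_nhds by metis
  then obtain A B where AB: "\<And>k. k \<in> K \<Longrightarrow> open (A k)" "\<And>k. k \<in> K \<Longrightarrow> k \<in> A k"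
    "\<And>k. k \<in> K \<Longrightarrow> eventually (B k) G" "\<And>k x y. k \<in> K \<Longrightarrow> x \<in> A k \<Longrightarrow> B k y \<Longrightarrow> Q (x, y)"
    by metis
  have "K \<subseteq> (\<Union>k\<in>K. A k)" using AB(2) by blast
  then obtain C where C: "C \<subseteq> K" "finite C" "K \<subseteq> (\<Union>k\<in>C. A k)"
    using compactE_image[OF assms(1), of K A] AB(1) by metis
  have "\<forall>\<^sub>F y in G. \<forall>k\<in>C. B k y"
    using C AB(3) by (intro eventually_ball_finite) auto
  then show ?thesis
    by eventually_elim (use C AB(4) in blast)
qed

lemma isCont_tendsto_nhds: "isCont f x \<Longrightarrow> (f \<longlongrightarrow> f x) (nhds x)"
  by (metis isCont_def tendsto_at_iff_tendsto_nhds)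

text \<open>The adjoint of an isometry of \<open>'a\<close> onto the orthogonal complement of
  \<open>L\<close> vanishes exactly on the double complement, which is \<open>L\<close>. Having the
  domain type of the maps as codomain turns membership in a manifold of complementary dimension into
  a square system of equations.\<close>

lemma subspace_eq_kernel:
  fixes L :: "'b::euclidean_space set"
  assumes "subspace L" and "DIM('b) = dim L + DIM('a)"
  obtains \<pi> :: "'b \<Rightarrow> 'a::euclidean_space" where "linear \<pi>" "surj \<pi>" "\<And>y. \<pi> y = 0 \<longleftrightarrow> y \<in> L"
proof -
  have "{y \<in> UNIV. \<forall>x\<in>L. orthogonal x y} = L\<^sup>\<bottom>"
    by (auto simp: orthogonal_comp_def)
  then have "dim (L\<^sup>\<bottom>) = dim (UNIV :: 'a set)"
    using dim_subspace_orthogonal_to_vectors[OF assms(1) subspace_UNIV subset_UNIV] assms(2) by simp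
  from isometries_subspaces[OF subspace_UNIV subspace_orthogonal_comp this[symmetric]]
  obtain h :: "'a \<Rightarrow> 'b" where h: "linear h" "range h = L\<^sup>\<bottom>" "\<And>x. norm (h x) = norm x"
    by (metis UNIV_I)
  define \<pi> where "\<pi> = adjoint h"
  have \<pi>: "x \<bullet> \<pi> y = h x \<bullet> y" for x y
    unfolding \<pi>_def by (rule adjoint_works[OF h(1)])
  have lin: "linear \<pi>" unfolding \<pi>_def by (rule adjoint_linear[OF h(1)])
  have "\<pi> y = 0 \<longleftrightarrow> (\<forall>x. h x \<bullet> y = 0)" for y
    by (metis \<pi> inner_eq_zero_iff inner_zero_right)
  also have "(\<forall>x. h x \<bullet> y = 0) \<longleftrightarrow> y \<in> (L\<^sup>\<bottom>)\<^sup>\<bottom>" for y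
    unfolding h(2)[symmetric] by (auto simp: orthogonal_comp_def orthogonal_def)
  finally have ker: "\<pi> y = 0 \<longleftrightarrow> y \<in> L" for y
    using orthogonal_comp_self[OF assms(1)] by simp
  have "x = 0" if "\<pi> (h x) = 0" for x
    using \<pi>[of x "h x"] h(3)[of x] that by simp
  then have "inj (\<pi> \<circ> h)"
    using linear_injective_0[OF linear_compose[OF h(1) lin]] by simp
  then have "surj (\<pi> \<circ> h)"
    using linear_injective_imp_surjective[OF linear_compose[OF h(1) lin]] by simp
  then have "surj \<pi>" by (metis comp_surj fun.set_map image_comp subset_antisym subset_UNIV image_mono)
  with lin ker show thesis using that by blast
qed

section \<open>Local unique solvability at a transversal intersection\<close>

lemma local_unique_solution:
  fixes f :: "real \<Rightarrow> 'a::euclidean_space \<Rightarrow> 'b::euclidean_space"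
  assumes M: "smooth_submanifold d M" "DIM('b) = d + DIM('a)"
    and df: "\<And>t x. (f t has_derivative f' t x) (at x)"
    and cf: "continuous_on UNIV (\<lambda>(t, x). f t x)"
    and cf': "\<And>v. continuous_on UNIV (\<lambda>(t, x). f' t x v)"
    and mem: "f t0 x0 \<in> M" and tr: "transversal_at (f t0) M x0"
  shows "\<exists>\<rho>0>0. \<forall>\<rho>. 0 < \<rho> \<and> \<rho> \<le> \<rho>0 \<longrightarrow>
           (\<forall>\<^sub>F t in nhds t0. \<exists>!x. x \<in> cball x0 \<rho> \<and> f t x \<in> M)"
proof -
  obtain U and \<phi> :: "'b \<Rightarrow> 'b" and \<phi>' L where c: "open U" "f t0 x0 \<in> U" "subspace L" "dim L = d"
    "\<And>y. y \<in> U \<Longrightarrow> (\<phi> has_derivative \<phi>' y) (at y)" "\<And>v. continuous_on U (\<lambda>y. \<phi>' y v)"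
    "bij (\<phi>' (f t0 x0))" "\<And>y. y \<in> U \<Longrightarrow> y \<in> M \<longleftrightarrow> \<phi> y \<in> L"
    "tangent_space M (f t0 x0) = {v. \<phi>' (f t0 x0) v \<in> L}"
    by (rule smooth_submanifold_chart[OF M(1) mem]) (rule that, assumption+)
  obtain \<pi> :: "'b \<Rightarrow> 'a" where \<pi>: "linear \<pi>" "surj \<pi>" "\<And>y. \<pi> y = 0 \<longleftrightarrow> y \<in> L"
    using subspace_eq_kernel[OF c(3)] M(2) c(4) by metis
  have bl\<pi>: "bounded_linear \<pi>" using \<pi>(1) linear_conv_bounded_linear by blast
  define \<Phi> where "\<Phi> t x = \<pi> (\<phi> (f t x))" for t x
  define D where "D t x v = \<pi> (\<phi>' (f t x) (f' t x v))" for t x v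
  define A where "A = D t0 x0"
  have \<Phi>0: "\<Phi> t x = 0 \<longleftrightarrow> f t x \<in> M" if "f t x \<in> U" for t x
    using c(8)[OF that] \<pi>(3) by (simp add: \<Phi>_def)
  have d\<Phi>: "(\<Phi> t has_derivative D t x) (at x)" if "f t x \<in> U" for t x
  proof -
    have "((\<lambda>x. \<phi> (f t x)) has_derivative (\<lambda>v. \<phi>' (f t x) (f' t x v))) (at x)"
      using has_derivative_compose[OF df c(5)[OF that]] .
    then show ?thesis
      unfolding \<Phi>_def[abs_def] D_def[abs_def] by (rule bounded_linear.has_derivative[OF bl\<pi>])
  qed
  have linD: "linear (D t x)" if "f t x \<in> U" for t x
    using d\<Phi>[OF that] has_derivative_linear by blast
  have f0U: "f t0 x0 \<in> U" by (rule c(2))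
  have linA: "linear A" unfolding A_def by (rule linD[OF f0U])
  \<comment> \<open>A target is lifted through \<open>\<pi>\<close> and \<open>\<phi>'\<close>.
    Transversality splits the lift into an image vector of \<open>f'\<close> and a tangent vector,
    and the latter is sent into \<open>L\<close>, the kernel of \<open>\<pi>\<close>.\<close>
  have "surj A"
  proof -
    have lin\<phi>: "linear (\<phi>' (f t0 x0))" using c(5)[OF f0U] has_derivative_linear by blast
    have "\<exists>v. A v = w" for w
    proof -
      obtain y where y: "\<pi> y = w" using \<pi>(2) by (metis surjD)
      obtain u where u: "\<phi>' (f t0 x0) u = y" using c(7) by (metis bij_pointE)
      obtain v \<tau> where v: "u = f' t0 x0 v + \<tau>" "\<tau> \<in> tangent_space M (f t0 x0)"
        using tr mem frechet_derivative_at[OF df] unfolding transversal_at_def by force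
      have "\<pi> (\<phi>' (f t0 x0) \<tau>) = 0" using v(2) c(9) \<pi>(3) by simp
      then have "A v = w"
        using u v(1) y by (simp add: A_def D_def linear_add[OF lin\<phi>] linear_add[OF \<pi>(1)] flip: u y)
      then show ?thesis ..
    qed
    then show ?thesis by (metis surjI)
  qed
  then have "inj A" using linear_surjective_imp_injective[OF linA] by simp
  obtain A' where A': "linear A'" "\<And>v. A' (A v) = v" "\<And>w. A (A' w) = w"
    using linear_injective_isomorphism[OF linA \<open>inj A\<close>] by metis
  have blA': "bounded_linear A'" using A'(1) linear_conv_bounded_linear by blast
  obtain K where K: "K > 0" "\<And>w. norm (A' w) \<le> K * norm w"
    using linear_bounded_pos[OF A'(1)] by metis
  \<comment> \<open>With \<open>K\<close> bounding the inverse \<open>A'\<close>, an error of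
    \<open>e\<close> in the derivative gives contraction factor \<open>K * e = 1/2\<close>. It is
    divided by \<open>DIM('a)\<close> below because the error is controlled on basis vectors
    only.\<close>
  define e where "e = 1 / (2 * K)"
  have "e > 0" using K by (simp add: e_def)
  have cD: "continuous (at (t0, x0)) (\<lambda>(t, x). D t x v)" for v
  proof -
    have tf: "((\<lambda>(t, x). f t x) \<longlongrightarrow> f t0 x0) (at (t0, x0))"
    proof -
      have "isCont (\<lambda>(t, x). f t x) (t0, x0)"
        using cf continuous_on_eq_continuous_at[OF open_UNIV] by blast
      then show ?thesis by (simp add: isCont_def)
    qed
    have tf': "((\<lambda>p. f' (fst p) (snd p) v) \<longlongrightarrow> f' t0 x0 v) (at (t0, x0))"
    proof -
      have "isCont (\<lambda>(t, x). f' t x v) (t0, x0)"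
        using cf'[of v] continuous_on_eq_continuous_at[OF open_UNIV] by blast
      then show ?thesis by (simp add: isCont_def case_prod_beta')
    qed
    have "isCont (\<lambda>y. \<phi>' y b) (f t0 x0)" for b
      using c(1,2,6) continuous_on_eq_continuous_at by blast
    then have t\<phi>: "((\<lambda>p. \<phi>' (f (fst p) (snd p)) b) \<longlongrightarrow> \<phi>' (f t0 x0) b) (at (t0, x0))" for b
      using isCont_tendsto_compose[OF _ tf, of "\<lambda>y. \<phi>' y b"] by (simp add: case_prod_beta')
    \<comment> \<open>\<open>\<phi>'\<close> is known to be continuous only against a fixed vector,
      while its argument \<open>f' t x v\<close> moves as well; expanding the argument in
      \<open>Basis\<close> separates the two dependences.\<close>
    have exp: "\<phi>' y w = (\<Sum>b\<in>Basis. (w \<bullet> b) *\<^sub>R \<phi>' y b)" if "y \<in> U" for y w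
    proof -
      have "linear (\<phi>' y)" using c(5)[OF that] has_derivative_linear by blast
      then show ?thesis
        using euclidean_representation[of w] by (metis (no_types, lifting) linear_scale linear_sum sum.cong)
    qed
    have "((\<lambda>p. \<pi> (\<Sum>b\<in>Basis. (f' (fst p) (snd p) v \<bullet> b) *\<^sub>R \<phi>' (f (fst p) (snd p)) b)) \<longlongrightarrow>
          \<pi> (\<Sum>b\<in>Basis. (f' t0 x0 v \<bullet> b) *\<^sub>R \<phi>' (f t0 x0) b)) (at (t0, x0))"
      using tf' t\<phi> by (intro bounded_linear.tendsto[OF bl\<pi>] tendsto_intros) (auto simp: case_prod_beta')
    moreover have "\<forall>\<^sub>F p in at (t0, x0). f (fst p) (snd p) \<in> U"
      using topological_tendstoD[OF tf c(1,2)] by (simp add: case_prod_beta')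
    then have "\<forall>\<^sub>F p in at (t0, x0). D (fst p) (snd p) v
        = \<pi> (\<Sum>b\<in>Basis. (f' (fst p) (snd p) v \<bullet> b) *\<^sub>R \<phi>' (f (fst p) (snd p)) b)"
      by (rule eventually_mono) (unfold D_def, subst exp, assumption, rule refl)
    moreover have "D t0 x0 v = \<pi> (\<Sum>b\<in>Basis. (f' t0 x0 v \<bullet> b) *\<^sub>R \<phi>' (f t0 x0) b)"
      unfolding D_def by (subst exp[OF f0U]) (rule refl)
    ultimately show ?thesis
      unfolding isCont_def case_prod_beta' by (simp add: tendsto_cong)
  qed
  have "\<forall>\<^sub>F p in nhds (t0, x0). f (fst p) (snd p) \<in> U \<and>
      (\<forall>i\<in>Basis. norm (D (fst p) (snd p) i - A i) < e / DIM('a))"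
  proof (intro eventually_conj eventually_ball_finite ballI)
    have "isCont (\<lambda>p. f (fst p) (snd p)) (t0, x0)"
      using cf continuous_on_eq_continuous_at[OF open_UNIV] unfolding case_prod_beta' by blast
    then have "((\<lambda>p. f (fst p) (snd p)) \<longlongrightarrow> f t0 x0) (nhds (t0, x0))"
      by (auto dest: isCont_tendsto_nhds)
    then show "\<forall>\<^sub>F p in nhds (t0, x0). f (fst p) (snd p) \<in> U"
      using c(1,2) by (rule topological_tendstoD)
  next
    fix i :: 'a assume "i \<in> Basis"
    have "0 < e / DIM('a)" using \<open>e > 0\<close> by simp
    moreover have "((\<lambda>p. D (fst p) (snd p) i) \<longlongrightarrow> A i) (nhds (t0, x0))"
      using isCont_tendsto_nhds[OF cD[of i]] by (simp add: A_def case_prod_beta')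
    ultimately show "\<forall>\<^sub>F p in nhds (t0, x0). norm (D (fst p) (snd p) i - A i) < e / DIM('a)"
      by (auto simp: tendsto_iff dist_norm)
  qed auto
  then obtain Pt Px where P: "eventually Pt (nhds t0)" "eventually Px (nhds x0)"
    "\<And>t x. Pt t \<Longrightarrow> Px x \<Longrightarrow> f t x \<in> U \<and> (\<forall>i\<in>Basis. norm (D t x i - A i) < e / DIM('a))"
    unfolding nhds_prod eventually_prod_filter by auto
  obtain \<rho>1 where \<rho>1: "\<rho>1 > 0" "\<And>x. dist x x0 < \<rho>1 \<Longrightarrow> Px x"
    using P(2) unfolding eventually_nhds_metric by blast
  have "\<forall>\<^sub>F t in nhds t0. \<exists>!x. x \<in> cball x0 \<rho> \<and> f t x \<in> M" if \<rho>: "0 < \<rho>" "\<rho> \<le> \<rho>1 / 2" for \<rho>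
  proof -
    have Px: "Px x" if "x \<in> cball x0 \<rho>" for x
      using that \<rho> \<rho>1 by (auto simp: dist_commute)
    have small: "norm (D t x v - A v) \<le> e * norm v" if "Pt t" "x \<in> cball x0 \<rho>" for t x v
    proof -
      have U: "f t x \<in> U" "\<forall>i\<in>Basis. norm (D t x i - A i) < e / DIM('a)"
        using P(3)[OF that(1) Px[OF that(2)]] by auto
      have lin: "linear (\<lambda>v. D t x v - A v)" using linear_compose_sub[OF linD[OF U(1)] linA] .
      have "D t x v - A v = (\<Sum>i\<in>Basis. (v \<bullet> i) *\<^sub>R (D t x i - A i))"
        using linear_sum[OF lin] linear_scale[OF lin] euclidean_representation[of v]
        by (metis (no_types, lifting) sum.cong)
      also have "norm \<dots> \<le> (\<Sum>i\<in>(Basis::'a set). norm v * (e / DIM('a)))"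
      proof (rule sum_norm_le)
        fix i :: 'a assume i: "i \<in> Basis"
        have "\<bar>v \<bullet> i\<bar> * norm (D t x i - A i) \<le> norm v * (e / DIM('a))"
          using U(2) i Basis_le_norm[OF i] by (intro mult_mono) (auto intro: less_imp_le)
        then show "norm ((v \<bullet> i) *\<^sub>R (D t x i - A i)) \<le> norm v * (e / DIM('a))" by simp
      qed
      also have "\<dots> = e * norm v" by simp
      finally show ?thesis .
    qed
    have "isCont (\<lambda>t. A' (\<Phi> t x0)) t0"
    proof -
      have "isCont (\<lambda>t. f t x0) t0"
        using continuous_on_compose2[OF cf, of UNIV "\<lambda>t. (t, x0)"]
        by (simp add: continuous_on_eq_continuous_at continuous_intros)
      moreover have "isCont \<phi> (f t0 x0)" using c(5)[OF f0U] has_derivative_continuous by blast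
      ultimately have "isCont (\<lambda>t. \<phi> (f t x0)) t0" using isCont_o2 by blast
      then show ?thesis
        unfolding \<Phi>_def by (intro bounded_linear.isCont[OF blA'] bounded_linear.isCont[OF bl\<pi>])
    qed
    moreover have "A' (\<Phi> t0 x0) = 0" using \<Phi>0[OF f0U] mem linear_0[OF A'(1)] by simp
    ultimately have "((\<lambda>t. A' (\<Phi> t x0)) \<longlongrightarrow> 0) (nhds t0)"
      by (metis isCont_tendsto_nhds)
    \<comment> \<open>A shift of the centre by at most half the radius, together with contraction
      factor 1/2, keeps the ball invariant.\<close>
    then have "\<forall>\<^sub>F t in nhds t0. norm (A' (\<Phi> t x0)) < \<rho> / 2"
      using order_tendstoD(2)[OF tendsto_norm_zero, of "\<lambda>t. A' (\<Phi> t x0)" _ "\<rho> / 2"] \<rho>(1) by simp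
    with P(1) show ?thesis
    proof eventually_elim
      case (elim t)
      define T where "T x = x - A' (\<Phi> t x)" for x
      have dT: "(T has_derivative (\<lambda>v. v - A' (D t x v))) (at x within cball x0 \<rho>)"
        if "x \<in> cball x0 \<rho>" for x
      proof -
        have "f t x \<in> U" using P(3)[OF elim(1) Px[OF that]] by simp
        from has_derivative_at_withinI[OF d\<Phi>[OF this]] show ?thesis
          unfolding T_def[abs_def]
          by (rule has_derivative_diff[OF has_derivative_ident bounded_linear.has_derivative[OF blA']])
      qed
      have on: "onorm (\<lambda>v. v - A' (D t x v)) \<le> 1 / 2" if "x \<in> cball x0 \<rho>" for x
      proof (rule onorm_le)
        fix v
        have "v - A' (D t x v) = A' (A v - D t x v)"
          by (simp add: linear_diff[OF A'(1)] A'(2))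
        also have "norm \<dots> \<le> K * (e * norm v)"
          using K small[OF elim(1) that, of v]
          by (smt (verit, best) mult_left_mono norm_minus_commute)
        also have "\<dots> = 1 / 2 * norm v" using K(1) by (simp add: e_def)
        finally show "norm (v - A' (D t x v)) \<le> 1 / 2 * norm v" .
      qed
      have contr: "dist (T x) (T y) \<le> 1 / 2 * dist x y" if "x \<in> cball x0 \<rho>" "y \<in> cball x0 \<rho>" for x y
        using differentiable_bound[OF convex_cball dT on that] by (simp add: dist_norm)
      have "T x \<in> cball x0 \<rho>" if "x \<in> cball x0 \<rho>" for x
      proof -
        have "dist (T x) (T x0) \<le> \<rho> / 2" using contr[OF that, of x0] \<rho> that by (simp add: dist_commute)
        moreover have "dist (T x0) x0 \<le> \<rho> / 2" using elim(2) by (simp add: T_def dist_norm)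
        ultimately show ?thesis
          using dist_triangle[of "T x" x0 "T x0"] by (simp add: dist_commute)
      qed
      then have "\<exists>!x\<in>cball x0 \<rho>. T x = x"
        using \<rho> contr by (intro Banach_fix[where c = "1/2"]) (auto intro: compact_imp_complete)
      moreover have "T x = x \<longleftrightarrow> f t x \<in> M" if "x \<in> cball x0 \<rho>" for x
      proof -
        have "T x = x \<longleftrightarrow> \<Phi> t x = 0"
          unfolding T_def using A'(3) linear_0[OF A'(1)] linear_0[OF linA]
          by (metis add_diff_cancel_left' diff_add_cancel diff_zero right_minus_eq)
        then show ?thesis using \<Phi>0 P(3)[OF elim(1) Px[OF that]] by simp
      qed
      ultimately show ?case by metis
    qed
  qed
  then show ?thesis using \<rho>1(1) by (intro exI[of _ "\<rho>1 / 2"]) auto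
qed

subsection \<open>Interpolation of 1-jets by maps of class C2\<close>

lemma Ck_on_2I:
  assumes f': "\<And>x. (f has_derivative f' x) (at x)"
    and f'': "\<And>v x. ((\<lambda>x. f' x v) has_derivative f'' v x) (at x)"
    and c: "\<And>v w. continuous_on UNIV (\<lambda>x. f'' v x w)"
  shows "Ck_on 2 UNIV f"
proof -
  have "frechet_derivative f (at x) = f' x" for x
    using frechet_derivative_at[OF f'] by simp
  moreover have "frechet_derivative (\<lambda>x. f' x v) (at x) = f'' v x" for v x
    using frechet_derivative_at[OF f''] by simp
  ultimately show ?thesis
    using differentiableI[OF f'] differentiableI[OF f''] c by (simp add: numeral_2_eq_2)
qed

lemma Ck_on_2D:
  assumes "Ck_on 2 UNIV f"
  shows "(f has_derivative frechet_derivative f (at x)) (at x)"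
    and "((\<lambda>x. frechet_derivative f (at x) v) has_derivative
           frechet_derivative (\<lambda>x. frechet_derivative f (at x) v) (at x)) (at x)"
    and "continuous_on UNIV (\<lambda>x. frechet_derivative (\<lambda>x. frechet_derivative f (at x) v) (at x) w)"
  using assms by (auto simp: numeral_2_eq_2 simp flip: frechet_derivative_works)

text \<open>The common majorant \<open>m\<close> makes the tails of the differentiated series at
  most \<open>e * norm v\<close>, uniformly in \<open>x\<close>; this is the uniformity that
  termwise differentiation requires.\<close>

lemma has_derivative_suminf:
  fixes h :: "nat \<Rightarrow> 'a::euclidean_space \<Rightarrow> 'b::euclidean_space"
  assumes d: "\<And>n x. (h n has_derivative h' n x) (at x)"
    and b: "\<And>n x. norm (h n x) \<le> B * m n"
    and b': "\<And>n x v. norm (h' n x v) \<le> B' * m n * norm v"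
    and m: "summable m"
  shows "((\<lambda>x. \<Sum>n. h n x) has_derivative (\<lambda>v. \<Sum>n. h' n x v)) (at x)"
proof -
  have sh: "summable (\<lambda>n. h n x)" for x
    using b by (intro summable_comparison_test'[OF summable_mult[OF m]]) auto
  have sh': "summable (\<lambda>n. h' n x v)" for x v
    using b'[of _ x v] by (intro summable_comparison_test'[OF summable_mult[OF summable_mult2[OF m]], of 0 _ B' "norm v"])
      (auto simp: mult_ac)
  have tail: "\<forall>\<^sub>F n in sequentially. \<forall>x\<in>UNIV. \<forall>v. norm ((\<Sum>i<n. h' i x v) - (\<Sum>i. h' i x v)) \<le> e * norm v"
    if "e > 0" for e
  proof -
    have "(\<lambda>n. (\<Sum>i<n. B' * m i)) \<longlonglongrightarrow> (\<Sum>i. B' * m i)"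
      using summable_LIMSEQ[OF summable_mult[OF m]] .
    then have "\<forall>\<^sub>F n in sequentially. dist (\<Sum>i<n. B' * m i) (\<Sum>i. B' * m i) < e"
      using that by (rule tendstoD)
    then show ?thesis
    proof eventually_elim
      case (elim n)
      have "norm ((\<Sum>i<n. h' i x v) - (\<Sum>i. h' i x v)) \<le> e * norm v" for x v
      proof -
        have "norm ((\<Sum>i<n. h' i x v) - (\<Sum>i. h' i x v)) = norm (\<Sum>i. h' (i + n) x v)"
          using suminf_minus_initial_segment[OF sh', of n x v] by (simp add: norm_minus_commute)
        also have "\<dots> \<le> (\<Sum>i. B' * m (i + n) * norm v)"
          by (intro norm_suminf_le b' summable_mult2 summable_mult summable_ignore_initial_segment m)
        also have "\<dots> = (\<Sum>i. B' * m (i + n)) * norm v"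
          by (intro suminf_mult2[symmetric] summable_mult summable_ignore_initial_segment m)
        also have "(\<Sum>i. B' * m (i + n)) = (\<Sum>i. B' * m i) - (\<Sum>i<n. B' * m i)"
          by (intro suminf_minus_initial_segment summable_mult m)
        also have "\<dots> * norm v \<le> e * norm v"
          using elim by (intro mult_right_mono) (auto simp: dist_real_def)
        finally show ?thesis .
      qed
      then show ?case by blast
    qed
  qed
  obtain g where g: "\<And>x. (\<lambda>n. h n x) sums g x"
    "\<And>x. (g has_derivative (\<lambda>v. \<Sum>n. h' n x v)) (at x)"
    using has_derivative_series[OF convex_UNIV d tail UNIV_I summable_sums[OF sh[of 0]]] by auto
  have "g = (\<lambda>x. \<Sum>n. h n x)" using g(1) by (auto simp: sums_iff)
  with g(2) show ?thesis by simp
qed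

lemma continuous_on_suminf_majorized:
  fixes h :: "nat \<Rightarrow> 'a::topological_space \<Rightarrow> 'b::banach"
  assumes "\<And>n. continuous_on S (h n)" and "\<And>n x. x \<in> S \<Longrightarrow> norm (h n x) \<le> m n" and "summable m"
  shows "continuous_on S (\<lambda>x. \<Sum>n. h n x)"
  by (rule uniform_limit_theorem[OF _ Weierstrass_m_test[OF assms(2,3)]])
     (auto intro!: always_eventually continuous_on_sum assms(1))

section \<open>The cutoff profile\<close>

text \<open>At the corner the difference quotient is itself \<open>max 0 h ^ Suc n\<close>, which
  tends to 0. Each derivative lowers the exponent by one, which is why \<open>bump\<close> is a
  cube: two derivatives still leave a continuous function.\<close>

lemma DERIV_max_power:
  fixes s :: real
  shows "((\<lambda>s. max 0 s ^ Suc (Suc n)) has_real_derivative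
           real (Suc (Suc n)) * max 0 s ^ Suc n) (at s)"
proof -
  consider "s < 0" | "s > 0" | "s = 0" by linarith
  then show ?thesis
  proof cases
    case 1
    have "((\<lambda>s::real. 0) has_real_derivative 0) (at s)" by simp
    then have "((\<lambda>s. max 0 s ^ Suc (Suc n)) has_real_derivative 0) (at s)"
      by (rule has_field_derivative_transform_within_open[where S = "{..<0}"]) (use 1 in auto)
    then show ?thesis using 1 by simp
  next
    case 2
    have "((\<lambda>s. s ^ Suc (Suc n)) has_real_derivative real (Suc (Suc n)) * s ^ Suc n) (at s)"
      by (rule DERIV_pow[THEN DERIV_cong]) simp
    then have "((\<lambda>s. max 0 s ^ Suc (Suc n)) has_real_derivative real (Suc (Suc n)) * s ^ Suc n) (at s)"
      by (rule has_field_derivative_transform_within_open[where S = "{0<..}"]) (use 2 in auto)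
    then show ?thesis using 2 by simp
  next
    case 3
    have "(\<lambda>h::real. max 0 h ^ Suc n) \<midarrow>0\<rightarrow> max 0 0 ^ Suc n"
      by (intro tendsto_power tendsto_max tendsto_const tendsto_ident_at)
    then have lim: "(\<lambda>h::real. max 0 h ^ Suc n) \<midarrow>0\<rightarrow> 0" by simp
    have "(\<lambda>h::real. max 0 h ^ Suc (Suc n) / h) \<midarrow>0\<rightarrow> 0"
      by (rule tendsto_cong[THEN iffD1, OF _ lim])
         (auto simp: eventually_at max_def intro!: exI[of _ 1])
    then show ?thesis using 3 by (simp add: DERIV_def)
  qed
qed

text \<open>Only the first-order data at \<open>1\<close> and being \<open>C\<^sup>2\<close> matter: multiplying by \<open>bump\<close> of
  \<open>(|y - a| / r)\<^sup>2\<close> keeps the 1-jet on the sphere of radius \<open>r\<close>.\<close>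

definition bump :: "real \<Rightarrow> real" where
  "bump u = max 0 (1 - 4 * (u - 1)\<^sup>2) ^ 3"

definition bump' :: "real \<Rightarrow> real" where
  "bump' u = 3 * max 0 (1 - 4 * (u - 1)\<^sup>2) ^ 2 * (- 8 * (u - 1))"

definition bump'' :: "real \<Rightarrow> real" where
  "bump'' u = 6 * max 0 (1 - 4 * (u - 1)\<^sup>2) * (- 8 * (u - 1))\<^sup>2 - 24 * max 0 (1 - 4 * (u - 1)\<^sup>2) ^ 2"

lemma bump_derivative: "(bump has_real_derivative bump' u) (at u)"
proof -
  have q: "((\<lambda>u. 1 - 4 * (u - 1)\<^sup>2) has_real_derivative - 8 * (u - 1)) (at u)"
    by (auto intro!: derivative_eq_intros)
  show ?thesis
    using DERIV_chain2[OF DERIV_max_power[of 1] q]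
    by (simp add: bump_def[abs_def] bump'_def numeral_2_eq_2 numeral_3_eq_3)
qed

lemma bump'_derivative: "(bump' has_real_derivative bump'' u) (at u)"
proof -
  let ?m = "\<lambda>u::real. max 0 (1 - 4 * (u - 1)\<^sup>2)"
  have q: "((\<lambda>u. 1 - 4 * (u - 1)\<^sup>2) has_real_derivative - 8 * (u - 1)) (at u)"
    by (auto intro!: derivative_eq_intros)
  have "((\<lambda>u. ?m u ^ 2) has_real_derivative 2 * ?m u * (- 8 * (u - 1))) (at u)"
    using DERIV_chain2[OF DERIV_max_power[of 0] q] by (simp add: numeral_2_eq_2)
  moreover have "((\<lambda>u. - 8 * (u - 1)) has_real_derivative - 8) (at u)"
    by (auto intro!: derivative_eq_intros)
  ultimately have "((\<lambda>u. 3 * ?m u ^ 2 * (- 8 * (u - 1))) has_real_derivative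
      3 * (2 * ?m u * (- 8 * (u - 1))) * (- 8 * (u - 1)) + - 8 * (3 * ?m u ^ 2)) (at u)"
    by (intro DERIV_mult DERIV_cmult)
  then show ?thesis
    unfolding bump'_def[abs_def] bump''_def by (rule DERIV_cong) (simp add: algebra_simps power2_eq_square)
qed

lemma continuous_on_bump'': "continuous_on S bump''"
  unfolding bump''_def[abs_def] by (intro continuous_intros)

lemma bump_at_1: "bump 1 = 1" "bump' 1 = 0"
  by (auto simp: bump_def bump'_def)

text \<open>The factor 4 in \<open>bump\<close> fixes this interval. With \<open>u\<close> the
  squared distance over \<open>r\<^sup>2\<close>, the cutoff lives between
  \<open>r\<^sup>2 / 2\<close> and \<open>3/2 * r\<^sup>2\<close>; squared radii that drop by a
  factor of at least 4 therefore give disjoint shells.\<close>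

lemma bump_support:
  assumes "u \<le> 1/2 \<or> u \<ge> 3/2"
  shows "bump u = 0" "bump' u = 0" "bump'' u = 0"
proof -
  have "(1/2)\<^sup>2 \<le> (u - 1)\<^sup>2"
    using assms abs_le_square_iff[of "1/2" "u - 1"] by (auto simp: abs_if)
  then have "max 0 (1 - 4 * (u - 1)\<^sup>2) = 0" by (simp add: power2_eq_square)
  then show "bump u = 0" "bump' u = 0" "bump'' u = 0"
    by (simp_all add: bump_def bump'_def bump''_def)
qed

text \<open>On the support the linear factor \<open>- 8 * (u - 1)\<close> is at most 4 in absolute
  value, so \<open>bump''\<close> is bounded by 6 * 16 + 24 = 120. The bounds 1 and 12 for the other
  two are relaxed to the same constant.\<close>

lemma bump_bound: "\<bar>bump u\<bar> \<le> 120" "\<bar>bump' u\<bar> \<le> 120" "\<bar>bump'' u\<bar> \<le> 120"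
proof -
  have "\<bar>bump u\<bar> \<le> 120 \<and> \<bar>bump' u\<bar> \<le> 120 \<and> \<bar>bump'' u\<bar> \<le> 120"
  proof (cases "u \<le> 1/2 \<or> u \<ge> 3/2")
    case True
    then show ?thesis using bump_support by simp
  next
    case False
    define m where "m = max 0 (1 - 4 * (u - 1)\<^sup>2)"
    define w where "w = - 8 * (u - 1)"
    have m: "0 \<le> m" "m \<le> 1" by (auto simp: m_def)
    have w: "\<bar>w\<bar> \<le> 4" using False by (auto simp: w_def abs_if)
    then have w2: "w\<^sup>2 \<le> 16" using abs_le_square_iff[of w 4] by simp
    have m2: "0 \<le> m\<^sup>2" "m\<^sup>2 \<le> 1" using m by (auto simp: power_le_one)
    have "m ^ 3 \<le> 1" "0 \<le> m ^ 3" using m by (auto simp: power_le_one)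
    moreover have "\<bar>3 * m\<^sup>2 * w\<bar> \<le> 3 * 1 * 4"
      unfolding abs_mult using m2 w by (intro mult_mono) auto
    moreover have "m * w\<^sup>2 \<le> 1 * 16"
      using m w2 by (intro mult_mono) auto
    moreover have "0 \<le> m * w\<^sup>2" using m by simp
    ultimately have "\<bar>6 * (m * w\<^sup>2) - 24 * m\<^sup>2\<bar> \<le> 120" using m2 by linarith
    then have "\<bar>6 * m * w\<^sup>2 - 24 * m\<^sup>2\<bar> \<le> 120" by (simp only: mult.assoc)
    moreover note \<open>m ^ 3 \<le> 1\<close> \<open>0 \<le> m ^ 3\<close> \<open>\<bar>3 * m\<^sup>2 * w\<bar> \<le> 3 * 1 * 4\<close>
    ultimately show ?thesis
      unfolding bump_def bump'_def bump''_def m_def[symmetric] w_def[symmetric] by simp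
  qed
  then show "\<bar>bump u\<bar> \<le> 120" "\<bar>bump' u\<bar> \<le> 120" "\<bar>bump'' u\<bar> \<le> 120" by auto
qed

section \<open>Gluing jets on spherical shells\<close>

text \<open>Scaling: on the shell the first and second derivatives of the cutoff are of order 1/r
  and 1/r^2, which the sizes r and r^2 of \<open>K'\<close> and \<open>K\<close> compensate, so the
  bound on \<open>h''\<close> is free of \<open>r\<close>. The constants collect the product rule:
  480 = 120 * 4 and 2160 = 120 * 16 + 120 * 2 bound the derivatives of the cutoff, whence 600 = 120
  + 480 and 3120 = 2 * 480 + 2160.\<close>

lemma cutoff_shell:
  fixes a :: "'a::euclidean_space" and K :: "'a \<Rightarrow> 'b::euclidean_space"
  assumes r: "r > 0" and m: "m \<ge> 0" and C: "\<And>v. C v \<ge> 0"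
    and dK: "\<And>y. (K has_derivative K' y) (at y)"
    and dK': "\<And>v y. ((\<lambda>y. K' y v) has_derivative K'' v y) (at y)"
    and cK: "\<And>v w. continuous_on UNIV (\<lambda>y. K'' v y w)"
    and b: "\<And>y. norm (y - a) \<le> 2 * r \<Longrightarrow> norm (K y) \<le> m * r\<^sup>2"
      "\<And>y v. norm (y - a) \<le> 2 * r \<Longrightarrow> norm (K' y v) \<le> m * r * norm v"
      "\<And>y v w. norm (y - a) \<le> 2 * r \<Longrightarrow> norm (K'' v y w) \<le> C v * m * norm w"
  shows "\<exists>h h' h''. (\<forall>y. (h has_derivative h' y) (at y)) \<and>
    (\<forall>v y. ((\<lambda>y. h' y v) has_derivative h'' v y) (at y)) \<and>
    (\<forall>v w. continuous_on UNIV (\<lambda>y. h'' v y w)) \<and>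
    (\<forall>y. norm (h y) \<le> 120 * m * r\<^sup>2) \<and> (\<forall>y v. norm (h' y v) \<le> 600 * m * r * norm v) \<and>
    (\<forall>v y w. norm (h'' v y w) \<le> (3120 * norm v + 120 * C v) * m * norm w) \<and>
    (\<forall>y. (norm (y - a))\<^sup>2 \<le> r\<^sup>2 / 2 \<or> (norm (y - a))\<^sup>2 \<ge> 3 / 2 * r\<^sup>2 \<longrightarrow> h y = 0 \<and> h' y = (\<lambda>_. 0)) \<and>
    (\<forall>y. norm (y - a) = r \<longrightarrow> h y = K y \<and> h' y = K' y)"
proof -
  define q where "q y = 1 / r\<^sup>2 * ((y - a) \<bullet> (y - a))" for y
  define u where "u y = bump (q y)" for y
  define q' where "q' y v = 2 * ((y - a) \<bullet> v) / r\<^sup>2" for y v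
  define u' where "u' y v = bump' (q y) * q' y v" for y v
  define u'' where "u'' v y w = bump'' (q y) * q' y w * q' y v + bump' (q y) * (2 * (w \<bullet> v) / r\<^sup>2)" for v y w
  define h where "h y = u y *\<^sub>R K y" for y
  define h' where "h' y v = u y *\<^sub>R K' y v + u' y v *\<^sub>R K y" for y v
  define h'' where "h'' v y w = (u y *\<^sub>R K'' v y w + u' y w *\<^sub>R K' y v) + (u' y v *\<^sub>R K' y w + u'' v y w *\<^sub>R K y)" for v y w
  have dq: "(q has_derivative q' y) (at y)" for y
  proof -
    have "((\<lambda>y. (y - a) \<bullet> (y - a)) has_derivative (\<lambda>v. 2 * ((y - a) \<bullet> v))) (at y)"
      by (auto intro!: derivative_eq_intros simp: inner_commute)
    from has_derivative_mult_right[OF this, of "1 / r\<^sup>2"] show ?thesis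
      by (simp add: q_def[abs_def] q'_def[abs_def])
  qed
  have du: "(u has_derivative u' y) (at y)" for y
    using has_derivative_compose[OF dq bump_derivative[unfolded has_field_derivative_def]]
    by (simp add: u_def[abs_def] u'_def[abs_def])
  have dbq: "((\<lambda>y. bump' (q y)) has_derivative (\<lambda>w. bump'' (q y) * q' y w)) (at y)" for y
    using has_derivative_compose[OF dq bump'_derivative[unfolded has_field_derivative_def]] by simp
  have dq': "((\<lambda>y. q' y v) has_derivative (\<lambda>w. 2 * (w \<bullet> v) / r\<^sup>2)) (at y)" for v y
  proof -
    have "((\<lambda>y. (y - a) \<bullet> v) has_derivative (\<lambda>w. w \<bullet> v)) (at y)"
      by (auto intro!: derivative_eq_intros)
    from has_derivative_mult_right[OF this, of "2 / r\<^sup>2"] show ?thesis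
      by (simp add: q'_def)
  qed
  have du': "((\<lambda>y. u' y v) has_derivative u'' v y) (at y)" for v y
    unfolding u'_def u''_def[abs_def]
    by (rule has_derivative_eq_rhs[OF has_derivative_mult[OF dbq dq']])
       (auto simp: fun_eq_iff algebra_simps)
  have dh: "(h has_derivative h' y) (at y)" for y
    using has_derivative_scaleR[OF du dK] by (simp add: h_def[abs_def] h'_def[abs_def])
  have dh': "((\<lambda>y. h' y v) has_derivative h'' v y) (at y)" for v y
    unfolding h'_def h''_def[abs_def]
    by (intro has_derivative_add has_derivative_scaleR du du' dK dK')
  have cd: "continuous_on UNIV g" if "\<And>y. (g has_derivative g' y) (at y)" for g :: "'a \<Rightarrow> 'c::euclidean_space" and g'
    by (intro continuous_at_imp_continuous_on ballI has_derivative_continuous[OF that])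
  have cb: "continuous_on UNIV (\<lambda>y. bump'' (q y))"
    using continuous_on_compose2[OF continuous_on_bump'' cd[OF dq]] by auto
  have ch: "continuous_on UNIV (\<lambda>y. h'' v y w)" for v w
    unfolding h''_def u''_def
    by (intro continuous_on_add continuous_on_scaleR continuous_on_mult continuous_on_const
        cK cd[OF dK] cd[OF dK'] cd[OF du] cd[OF du'] cd[OF dbq] cd[OF dq'] cb)
  have zero: "h y = 0 \<and> h' y = (\<lambda>_. 0) \<and> h'' v y = (\<lambda>_. 0)"
    if "(norm (y - a))\<^sup>2 \<le> r\<^sup>2 / 2 \<or> (norm (y - a))\<^sup>2 \<ge> 3 / 2 * r\<^sup>2" for y v
  proof -
    have "q y \<le> 1/2 \<or> q y \<ge> 3/2"
      using that r by (auto simp: q_def power2_norm_eq_inner field_simps)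
    then show ?thesis
      using bump_support[of "q y"]
      by (auto simp: h_def h'_def h''_def u_def u'_def u''_def fun_eq_iff)
  qed
  have one: "h y = K y \<and> h' y = K' y" if "norm (y - a) = r" for y
  proof -
    have "q y = 1" using that r by (simp add: q_def flip: power2_norm_eq_inner)
    then show ?thesis by (simp add: h_def h'_def u_def u'_def bump_at_1 fun_eq_iff)
  qed
  have bounds: "norm (h y) \<le> 120 * m * r\<^sup>2 \<and> norm (h' y v) \<le> 600 * m * r * norm v \<and>
      norm (h'' v y w) \<le> (3120 * norm v + 120 * C v) * m * norm w" for y v w
  proof (cases "(norm (y - a))\<^sup>2 \<ge> 3 / 2 * r\<^sup>2")
    case True
    then show ?thesis using zero[of y v] r m C by simp
  next
    case False
    moreover have "0 \<le> r\<^sup>2" "(2 * r)\<^sup>2 = 4 * r\<^sup>2" by (simp_all add: power_mult_distrib)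
    ultimately have "(norm (y - a))\<^sup>2 \<le> (2 * r)\<^sup>2" by linarith
    moreover have "0 \<le> 2 * r" using r by simp
    ultimately have near: "norm (y - a) \<le> 2 * r" by (rule power2_le_imp_le)
    note b = b(1)[OF near] b(2)[OF near] b(3)[OF near]
    have q': "\<bar>q' y v\<bar> \<le> 4 / r * norm v" for v
    proof -
      have "\<bar>(y - a) \<bullet> v\<bar> \<le> 2 * r * norm v"
        using Cauchy_Schwarz_ineq2[of "y - a" v] mult_right_mono[OF near, of "norm v"] by simp
      then show ?thesis using r by (simp add: q'_def abs_mult field_simps power2_eq_square)
    qed
    have u: "\<bar>u y\<bar> \<le> 120" unfolding u_def by (rule bump_bound)
    have u': "\<bar>u' y v\<bar> \<le> 480 / r * norm v" for v
    proof -
      have "\<bar>u' y v\<bar> \<le> 120 * (4 / r * norm v)"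
        unfolding u'_def abs_mult by (intro mult_mono bump_bound q') auto
      then show ?thesis by simp
    qed
    have u'': "\<bar>u'' v y w\<bar> \<le> 2160 / r\<^sup>2 * norm v * norm w"
    proof -
      have "\<bar>bump'' (q y) * q' y w * q' y v\<bar> \<le> 120 * (4 / r * norm w) * (4 / r * norm v)"
        unfolding abs_mult using r by (intro mult_mono bump_bound q') auto
      moreover have "\<bar>bump' (q y) * (2 * (w \<bullet> v) / r\<^sup>2)\<bar> \<le> 120 * (2 * (norm w * norm v) / r\<^sup>2)"
      proof -
        have "\<bar>w \<bullet> v\<bar> / r\<^sup>2 \<le> norm w * norm v / r\<^sup>2"
          by (intro divide_right_mono Cauchy_Schwarz_ineq2) simp
        then have "\<bar>2 * (w \<bullet> v) / r\<^sup>2\<bar> \<le> 2 * (norm w * norm v) / r\<^sup>2"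
          by (simp add: abs_mult)
        then show ?thesis unfolding abs_mult[of "bump' (q y)"] by (intro mult_mono bump_bound) auto
      qed
      ultimately have "\<bar>u'' v y w\<bar> \<le> 120 * (4 / r * norm w) * (4 / r * norm v) + 120 * (2 * (norm w * norm v) / r\<^sup>2)"
        unfolding u''_def by linarith
      also have "\<dots> = 2160 / r\<^sup>2 * norm v * norm w" by (simp add: power2_eq_square field_simps)
      finally show ?thesis .
    qed
    have sc: "norm (c *\<^sub>R z) \<le> \<alpha> * \<beta>" if "\<bar>c\<bar> \<le> \<alpha>" "norm z \<le> \<beta>" for c \<alpha> \<beta> and z :: 'b
      using that by (simp add: mult_mono')
    have "norm (h y) \<le> 120 * (m * r\<^sup>2)" unfolding h_def by (intro sc u b)
    moreover have "norm (h' y v) \<le> 600 * m * r * norm v"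
    proof -
      have "norm (h' y v) \<le> 120 * (m * r * norm v) + (480 / r * norm v) * (m * r\<^sup>2)"
        unfolding h'_def by (intro norm_triangle_mono sc u u' b)
      also have "\<dots> = 600 * m * r * norm v" using r by (simp add: power2_eq_square field_simps)
      finally show ?thesis .
    qed
    moreover have "norm (h'' v y w) \<le> (3120 * norm v + 120 * C v) * m * norm w"
    proof -
      have "norm (h'' v y w) \<le> (120 * (C v * m * norm w) + (480 / r * norm w) * (m * r * norm v))
          + ((480 / r * norm v) * (m * r * norm w) + (2160 / r\<^sup>2 * norm v * norm w) * (m * r\<^sup>2))"
        unfolding h''_def by (intro norm_triangle_mono sc u u' u'' b)
      also have "\<dots> = (3120 * norm v + 120 * C v) * m * norm w"
        using r by (simp add: power2_eq_square field_simps)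
      finally show ?thesis .
    qed
    ultimately show ?thesis by simp
  qed
  show ?thesis
    using dh dh' ch zero one bounds
    by (intro exI[of _ h] exI[of _ h'] exI[of _ h'']) blast
qed

text \<open>The function is the sum of the \<open>K n\<close>, each cut off on the shell through
  \<open>x n\<close>. Halving the distances keeps every \<open>x k\<close> and \<open>a\<close>
  outside all foreign shells, so at \<open>x k\<close> only the \<open>k\<close>-th jet is seen and
  at \<open>a\<close> none. The weights \<open>B / 2 ^ n\<close> make the series of values, first
  and second derivatives converge uniformly.\<close>

lemma C2_interpolation:
  fixes a :: "'a::euclidean_space" and K :: "nat \<Rightarrow> 'a \<Rightarrow> 'b::euclidean_space"
  assumes x: "\<And>n. x n \<noteq> a" "\<And>n. norm (x (Suc n) - a) \<le> norm (x n - a) / 2"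
    and C: "\<And>v. C v \<ge> 0"
    and dK: "\<And>n y. (K n has_derivative K' n y) (at y)"
    and dK': "\<And>n v y. ((\<lambda>y. K' n y v) has_derivative K'' n v y) (at y)"
    and cK: "\<And>n v w. continuous_on UNIV (\<lambda>y. K'' n v y w)"
    and b: "\<And>n y. norm (y - a) \<le> 2 * norm (x n - a) \<Longrightarrow> norm (K n y) \<le> B / 2 ^ n * (norm (x n - a))\<^sup>2"
      "\<And>n y v. norm (y - a) \<le> 2 * norm (x n - a) \<Longrightarrow> norm (K' n y v) \<le> B / 2 ^ n * norm (x n - a) * norm v"
      "\<And>n y v w. norm (y - a) \<le> 2 * norm (x n - a) \<Longrightarrow> norm (K'' n v y w) \<le> C v * (B / 2 ^ n) * norm w"
    and B: "B \<ge> 0"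
  shows "\<exists>H. Ck_on 2 UNIV H \<and> H a = 0 \<and> (H has_derivative (\<lambda>_. 0)) (at a) \<and>
    (\<forall>n. H (x n) = K n (x n) \<and> (H has_derivative K' n (x n)) (at (x n)))"
proof -
  define r where "r n = norm (x n - a)" for n
  define m where "m n = B / 2 ^ n" for n :: nat
  have r: "r n > 0" for n using x(1) by (simp add: r_def)
  have m: "m n \<ge> 0" for n using B by (simp add: m_def)
  have "summable (\<lambda>n. B * (1 / 2) ^ n)" by (intro summable_mult summable_geometric) simp
  moreover have "m = (\<lambda>n. B * (1 / 2) ^ n)" by (simp add: m_def fun_eq_iff power_divide)
  ultimately have sm: "summable m" by simp
  have step: "r (Suc n) \<le> r n / 2" for n using x(2) by (simp add: r_def)
  have "r (Suc n) \<le> r n" for n using step[of n] r[of n] by simp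
  then have dec: "decseq r" by (simp add: decseq_Suc_iff)
  have half: "r j \<le> r i / 2" if "i < j" for i j
    using decseqD[OF dec, of "Suc i" j] step[of i] that by simp
  have "\<forall>n. \<exists>h h' h''. (\<forall>y. (h has_derivative h' y) (at y)) \<and>
    (\<forall>v y. ((\<lambda>y. h' y v) has_derivative h'' v y) (at y)) \<and>
    (\<forall>v w. continuous_on UNIV (\<lambda>y. h'' v y w)) \<and>
    (\<forall>y. norm (h y) \<le> 120 * m n * (r n)\<^sup>2) \<and> (\<forall>y v. norm (h' y v) \<le> 600 * m n * r n * norm v) \<and>
    (\<forall>v y w. norm (h'' v y w) \<le> (3120 * norm v + 120 * C v) * m n * norm w) \<and>
    (\<forall>y. (norm (y - a))\<^sup>2 \<le> (r n)\<^sup>2 / 2 \<or> (norm (y - a))\<^sup>2 \<ge> 3 / 2 * (r n)\<^sup>2 \<longrightarrow> h y = 0 \<and> h' y = (\<lambda>_. 0)) \<and>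
    (\<forall>y. norm (y - a) = r n \<longrightarrow> h y = K n y \<and> h' y = K' n y)"
    by (rule allI, rule cutoff_shell[OF r m C dK dK' cK]; unfold r_def m_def; rule b; assumption)
  then obtain h h' h'' where H0: "\<forall>n. (\<forall>y. (h n has_derivative h' n y) (at y)) \<and>
    (\<forall>v y. ((\<lambda>y. h' n y v) has_derivative h'' n v y) (at y)) \<and>
    (\<forall>v w. continuous_on UNIV (\<lambda>y. h'' n v y w)) \<and>
    (\<forall>y. norm (h n y) \<le> 120 * m n * (r n)\<^sup>2) \<and> (\<forall>y v. norm (h' n y v) \<le> 600 * m n * r n * norm v) \<and>
    (\<forall>v y w. norm (h'' n v y w) \<le> (3120 * norm v + 120 * C v) * m n * norm w) \<and>
    (\<forall>y. (norm (y - a))\<^sup>2 \<le> (r n)\<^sup>2 / 2 \<or> (norm (y - a))\<^sup>2 \<ge> 3 / 2 * (r n)\<^sup>2 \<longrightarrow> h n y = 0 \<and> h' n y = (\<lambda>_. 0)) \<and>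
    (\<forall>y. norm (y - a) = r n \<longrightarrow> h n y = K n y \<and> h' n y = K' n y)"
    unfolding choice_iff by (elim exE) (rule that)
  note H = H0[THEN spec, THEN conjunct1, rule_format]
    H0[THEN spec, THEN conjunct2, THEN conjunct1, rule_format]
    H0[THEN spec, THEN conjunct2, THEN conjunct2, THEN conjunct1, rule_format]
    H0[THEN spec, THEN conjunct2, THEN conjunct2, THEN conjunct2, THEN conjunct1, rule_format]
    H0[THEN spec, THEN conjunct2, THEN conjunct2, THEN conjunct2, THEN conjunct2, THEN conjunct1, rule_format]
    H0[THEN spec, THEN conjunct2, THEN conjunct2, THEN conjunct2, THEN conjunct2, THEN conjunct2, THEN conjunct1, rule_format]
    H0[THEN spec, THEN conjunct2, THEN conjunct2, THEN conjunct2, THEN conjunct2, THEN conjunct2, THEN conjunct2, THEN conjunct1, rule_format]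
    H0[THEN spec, THEN conjunct2, THEN conjunct2, THEN conjunct2, THEN conjunct2, THEN conjunct2, THEN conjunct2, THEN conjunct2, rule_format]
  have r0: "r n \<le> r 0" for n using decseqD[OF dec, of 0 n] by simp
  have b0: "norm (h n y) \<le> (120 * (r 0)\<^sup>2) * m n" for n y
  proof -
    have "120 * m n * (r n)\<^sup>2 \<le> 120 * m n * (r 0)\<^sup>2"
      using r0[of n] r[of n] m[of n] by (intro mult_left_mono power_mono) auto
    then show ?thesis using H(4)[of n y] by (simp add: mult_ac)
  qed
  have b1: "norm (h' n y v) \<le> (600 * r 0) * m n * norm v" for n y v
  proof -
    have "600 * m n * r n * norm v \<le> 600 * m n * r 0 * norm v"
      using r0[of n] m[of n] by (intro mult_left_mono mult_right_mono) auto
    then show ?thesis using H(5)[of n y v] by (simp add: mult_ac)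
  qed
  define G where "G y = (\<Sum>n. h n y)" for y
  define G' where "G' y v = (\<Sum>n. h' n y v)" for y v
  define G'' where "G'' v y w = (\<Sum>n. h'' n v y w)" for v y w
  have dG: "(G has_derivative G' y) (at y)" for y
    unfolding G_def[abs_def] G'_def[abs_def] using has_derivative_suminf[OF H(1) b0 b1 sm] .
  have b1': "norm (h' n y v) \<le> (600 * r 0 * norm v) * m n" for n y v
    using b1[of n y v] by (simp add: mult_ac)
  have dG': "((\<lambda>y. G' y v) has_derivative G'' v y) (at y)" for v y
    unfolding G'_def[abs_def] G''_def[abs_def] using has_derivative_suminf[OF H(2) b1' H(6) sm] .
  have cG: "continuous_on UNIV (\<lambda>y. G'' v y w)" for v w
    unfolding G''_def
    by (rule continuous_on_suminf_majorized[OF H(3), where m = "\<lambda>n. (3120 * norm v + 120 * C v) * m n * norm w"])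
       (auto intro!: H(6) summable_mult2 summable_mult sm)
  have Ga: "h n a = 0 \<and> h' n a = (\<lambda>_. 0)" for n using H(7)[of a n] by simp
  have off: "h n (x k) = 0 \<and> h' n (x k) = (\<lambda>_. 0)" if "n \<noteq> k" for n k
  proof (cases "n < k")
    case True
    have "(r k)\<^sup>2 \<le> (r n / 2)\<^sup>2" using half[OF True] r[of k] by (intro power_mono) auto
    also have "\<dots> \<le> (r n)\<^sup>2 / 2" by (simp add: power2_eq_square)
    finally show ?thesis using H(7)[of "x k" n] by (simp add: r_def)
  next
    case False
    then have "(2 * r n)\<^sup>2 \<le> (r k)\<^sup>2" using half[of k n] r[of n] that by (intro power_mono) auto
    moreover have "0 \<le> (r n)\<^sup>2" "(2 * r n)\<^sup>2 = 4 * (r n)\<^sup>2" by (simp_all add: power_mult_distrib)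
    ultimately have "3 / 2 * (r n)\<^sup>2 \<le> (r k)\<^sup>2" by linarith
    then show ?thesis using H(7)[of "x k" n] by (simp add: r_def)
  qed
  have on: "h k (x k) = K k (x k) \<and> h' k (x k) = K' k (x k)" for k using H(8)[of "x k" k] by (simp add: r_def)
  have "G (x k) = K k (x k) \<and> G' (x k) = K' k (x k)" for k
  proof -
    have "G (x k) = (\<Sum>n\<in>{k}. h n (x k))"
      unfolding G_def using off by (intro suminf_finite) auto
    moreover have "G' (x k) v = (\<Sum>n\<in>{k}. h' n (x k) v)" for v
      unfolding G'_def using off by (intro suminf_finite) auto
    ultimately show ?thesis using on[of k] by (simp add: fun_eq_iff)
  qed
  moreover have "G a = 0" "G' a = (\<lambda>_. 0)" using Ga by (auto simp: G_def G'_def fun_eq_iff)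
  ultimately show ?thesis
    using Ck_on_2I[OF dG dG' cG] dG by (intro exI[of _ G]) metis
qed

subsection \<open>The homotopy to the linearization\<close>

lemma Ck_on_2_add:
  assumes "Ck_on 2 UNIV f" and "Ck_on 2 UNIV g"
  shows "Ck_on 2 UNIV (\<lambda>x. f x + g x)"
  by (rule Ck_on_2I[OF has_derivative_add[OF Ck_on_2D(1)[OF assms(1)] Ck_on_2D(1)[OF assms(2)]]
        has_derivative_add[OF Ck_on_2D(2)[OF assms(1)] Ck_on_2D(2)[OF assms(2)]]
        continuous_on_add[OF Ck_on_2D(3)[OF assms(1)] Ck_on_2D(3)[OF assms(2)]]])

lemma linear_shift_has_derivative:
  fixes A :: "'a::euclidean_space \<Rightarrow> 'b::euclidean_space"
  assumes "linear A"
  shows "((\<lambda>x. A (x - a)) has_derivative A) (at x)"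
proof -
  have "((\<lambda>x. x - a) has_derivative (\<lambda>v. v)) (at x)" by (auto intro!: derivative_eq_intros)
  with assms show ?thesis
    using bounded_linear.has_derivative[of A "\<lambda>x. x - a" "\<lambda>v. v"] by (simp add: linear_conv_bounded_linear)
qed

text \<open>The mean value inequality is applied twice: to \<open>F'\<close> on the unit ball, and
  to the Taylor remainder on the ball of radius \<open>norm (y - a)\<close>, where its derivative is
  already small. Continuity of \<open>F''\<close> is available only for fixed directions, so
  compactness yields one constant per pair of directions; summing over \<open>Basis\<close> frees
  the direction \<open>w\<close>, while \<open>C\<close> still depends on \<open>v\<close>.\<close>

lemma C2_taylor_bounds:
  fixes F :: "'a::euclidean_space \<Rightarrow> 'b::euclidean_space"
  assumes dF: "\<And>x. (F has_derivative F' x) (at x)"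
    and dF': "\<And>v x. ((\<lambda>x. F' x v) has_derivative F'' v x) (at x)"
    and cF: "\<And>v w. continuous_on UNIV (\<lambda>x. F'' v x w)"
  obtains B C where "B \<ge> (1::real)" "\<And>v. C v \<ge> (0::real)"
    "\<And>y v w. y \<in> cball a 1 \<Longrightarrow> norm (F'' v y w) \<le> C v * norm w"
    "\<And>y v. y \<in> cball a 1 \<Longrightarrow> norm (F' a v - F' y v) \<le> B * norm (y - a) * norm v"
    "\<And>y. y \<in> cball a 1 \<Longrightarrow> norm (F a + F' a (y - a) - F y) \<le> B * (norm (y - a))\<^sup>2"
proof -
  have expand: "norm (A v) \<le> norm v * (\<Sum>i\<in>Basis. c i)"
    if "linear A" "\<And>i. i \<in> Basis \<Longrightarrow> norm (A i) \<le> c i"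
    for A :: "'a \<Rightarrow> 'b" and v :: 'a and c :: "'a \<Rightarrow> real"
  proof -
    have "A v = (\<Sum>i\<in>Basis. (v \<bullet> i) *\<^sub>R A i)"
      using linear_sum[OF that(1)] linear_scale[OF that(1)] euclidean_representation[of v]
      by (metis (no_types, lifting) sum.cong)
    also have "norm \<dots> \<le> (\<Sum>i\<in>Basis. norm v * c i)"
    proof (rule sum_norm_le)
      fix i :: 'a assume i: "i \<in> Basis"
      show "norm ((v \<bullet> i) *\<^sub>R A i) \<le> norm v * c i"
        using that(2)[OF i] Basis_le_norm[OF i] by (simp add: mult_mono')
    qed
    also have "\<dots> = norm v * (\<Sum>i\<in>Basis. c i)" by (simp add: sum_distrib_left)
    finally show ?thesis .
  qed
  have "\<exists>c\<ge>0. \<forall>y\<in>cball a 1. norm (F'' v y i) \<le> c" for v i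
  proof -
    have "compact ((\<lambda>y. F'' v y i) ` cball a 1)"
      by (intro compact_continuous_image compact_cball continuous_on_subset[OF cF]) auto
    then obtain c where c: "\<forall>z\<in>(\<lambda>y. F'' v y i) ` cball a 1. norm z \<le> c"
      using compact_imp_bounded bounded_iff by metis
    then have "0 \<le> norm (F'' v a i)" "norm (F'' v a i) \<le> c" by auto
    then have "0 \<le> c" by linarith
    with c show ?thesis by auto
  qed
  then obtain c where c: "\<And>v i. c v i \<ge> (0::real)"
    "\<And>v i y. y \<in> cball a 1 \<Longrightarrow> norm (F'' v y i) \<le> c v i"
    by metis
  define C where "C v = (\<Sum>i\<in>Basis. c v i)" for v
  have C0: "C v \<ge> 0" for v unfolding C_def by (intro sum_nonneg c)
  have b2: "norm (F'' v y w) \<le> C v * norm w" if "y \<in> cball a 1" for y v w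
    using expand[of "F'' v y" "c v" w] c(2)[OF that] has_derivative_linear[OF dF']
    by (simp add: C_def mult.commute)
  have b1: "norm (F' a v - F' y v) \<le> C v * norm (y - a)" if "y \<in> cball a 1" for y v
  proof -
    have "norm (F' y v - F' a v) \<le> C v * norm (y - a)"
      by (rule differentiable_bound[OF convex_cball has_derivative_at_withinI[OF dF'], of a 1])
         (use that b2 in \<open>auto intro!: onorm_le\<close>)
    then show ?thesis by (simp add: norm_minus_commute)
  qed
  \<comment> \<open>The summand 1 gives \<open>B \<ge> 1\<close>, so that a bound with factor 1 may
    later be weakened to one with factor \<open>4 * B\<close>.\<close>
  define B where "B = 1 + (\<Sum>i\<in>Basis. C i)"
  have B1: "B \<ge> 1" unfolding B_def using C0 by (simp add: sum_nonneg)
  have b1': "norm (F' a v - F' y v) \<le> B * norm (y - a) * norm v" if "y \<in> cball a 1" for y v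
  proof -
    have "linear (\<lambda>v. F' a v - F' y v)"
      using has_derivative_linear[OF dF] by (intro linear_compose_sub) auto
    then have "norm (F' a v - F' y v) \<le> norm v * (\<Sum>i\<in>Basis. C i * norm (y - a))"
      using b1[OF that] by (rule expand)
    also have "\<dots> = norm v * (\<Sum>i\<in>Basis. C i) * norm (y - a)" by (simp add: sum_distrib_right)
    also have "\<dots> \<le> norm v * B * norm (y - a)"
      unfolding B_def by (intro mult_right_mono mult_left_mono) auto
    finally show ?thesis by (simp add: mult_ac)
  qed
  have b0: "norm (F a + F' a (y - a) - F y) \<le> B * (norm (y - a))\<^sup>2" if y: "y \<in> cball a 1" for y
  proof -
    let ?s = "norm (y - a)"
    have lin: "linear (F' a)" using has_derivative_linear[OF dF] .
    have d: "((\<lambda>y. F a + F' a (y - a) - F y) has_derivative (\<lambda>v. F' a v - F' z v)) (at z within cball a ?s)" for z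
    proof -
      have "((\<lambda>y. F' a (y - a)) has_derivative F' a) (at z)"
        using linear_shift_has_derivative[OF lin] .
      then have "((\<lambda>y. F a + F' a (y - a) - F y) has_derivative (\<lambda>v. (0 + F' a v) - F' z v)) (at z)"
        by (intro has_derivative_diff has_derivative_add has_derivative_const dF)
      then show ?thesis by (simp add: has_derivative_at_withinI)
    qed
    have "norm ((F a + F' a (y - a) - F y) - (F a + F' a (a - a) - F a)) \<le> (B * ?s) * norm (y - a)"
    proof (rule differentiable_bound[OF convex_cball d])
      fix z assume z: "z \<in> cball a ?s"
      then have "z \<in> cball a 1" "norm (z - a) \<le> ?s" using y by (auto simp: dist_norm norm_minus_commute)
      then have zs: "B * norm (z - a) * norm v \<le> (B * ?s) * norm v" for v
        using B1 by (intro mult_right_mono mult_left_mono) auto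
      have "norm (F' a v - F' z v) \<le> (B * ?s) * norm v" for v
        using order_trans[OF b1'[OF \<open>z \<in> cball a 1\<close>] zs] .
      then show "onorm (\<lambda>v. F' a v - F' z v) \<le> B * ?s" by (rule onorm_le)
    qed (auto simp: dist_norm norm_minus_commute)
    then show ?thesis using linear_0[OF lin] by (simp add: power2_eq_square)
  qed
  show thesis by (rule that[OF B1 C0 b2 b1' b0])
qed

text \<open>Affine in \<open>t\<close>: members at two times differ by a multiple of the Taylor
  remainder of \<open>F\<close> at \<open>a\<close>, and this difference is what gets
  interpolated.\<close>

definition lin_homotopy :: "('a::euclidean_space \<Rightarrow> 'b::euclidean_space) \<Rightarrow> 'a \<Rightarrow> real \<Rightarrow> 'a \<Rightarrow> 'b" where
  "lin_homotopy F a t x = F x + t *\<^sub>R (linearization F a x - F x)"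

definition lin_homotopy' :: "('a::euclidean_space \<Rightarrow> 'b::euclidean_space) \<Rightarrow> 'a \<Rightarrow> real \<Rightarrow> 'a \<Rightarrow> 'a \<Rightarrow> 'b" where
  "lin_homotopy' F a t x v = frechet_derivative F (at x) v
     + t *\<^sub>R (frechet_derivative F (at a) v - frechet_derivative F (at x) v)"

context
  fixes F :: "'a::euclidean_space \<Rightarrow> 'b::euclidean_space" and a :: 'a
  assumes F: "Ck_on 2 UNIV F"
begin

lemma linearization_has_derivative:
  "(linearization F a has_derivative frechet_derivative F (at a)) (at x)"
proof -
  have lin: "linear (frechet_derivative F (at a))"
    using has_derivative_linear[OF Ck_on_2D(1)[OF F]] .
  have "((\<lambda>x. frechet_derivative F (at a) (x - a)) has_derivative frechet_derivative F (at a)) (at x)"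
    using linear_shift_has_derivative[OF lin] .
  from has_derivative_add[OF has_derivative_const this, of "F a"] show ?thesis
    by (simp add: linearization_def[abs_def])
qed

lemma lin_homotopy_has_derivative:
  "(lin_homotopy F a t has_derivative lin_homotopy' F a t x) (at x)"
  unfolding lin_homotopy_def[abs_def] lin_homotopy'_def[abs_def]
  by (intro has_derivative_add has_derivative_scaleR_right has_derivative_diff
      linearization_has_derivative Ck_on_2D(1)[OF F])

lemma frechet_lin_homotopy:
  "frechet_derivative (lin_homotopy F a t) (at x) = lin_homotopy' F a t x"
  using frechet_derivative_at[OF lin_homotopy_has_derivative] by simp

lemma Ck_on_2_lin_homotopy: "Ck_on 2 UNIV (lin_homotopy F a t)"
proof (rule Ck_on_2I[OF lin_homotopy_has_derivative])
  note D = Ck_on_2D[OF F]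
  fix v w x
  show "((\<lambda>x. lin_homotopy' F a t x v) has_derivative
     (\<lambda>w. frechet_derivative (\<lambda>x. frechet_derivative F (at x) v) (at x) w
        + t *\<^sub>R (0 - frechet_derivative (\<lambda>x. frechet_derivative F (at x) v) (at x) w))) (at x)"
    unfolding lin_homotopy'_def
    by (intro has_derivative_add has_derivative_scaleR_right has_derivative_diff has_derivative_const D)
  show "continuous_on UNIV (\<lambda>x. frechet_derivative (\<lambda>x. frechet_derivative F (at x) v) (at x) w
        + t *\<^sub>R (0 - frechet_derivative (\<lambda>x. frechet_derivative F (at x) v) (at x) w))"
    by (intro continuous_intros D(3))
qed

lemma continuous_on_lin_homotopy: "continuous_on UNIV (\<lambda>(t, x). lin_homotopy F a t x)"
  and continuous_on_lin_homotopy': "continuous_on UNIV (\<lambda>(t, x). lin_homotopy' F a t x v)"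
proof -
  have "continuous_on UNIV F"
    by (intro continuous_at_imp_continuous_on ballI has_derivative_continuous[OF Ck_on_2D(1)[OF F]])
  moreover have "continuous_on UNIV (linearization F a)"
    by (intro continuous_at_imp_continuous_on ballI has_derivative_continuous[OF linearization_has_derivative])
  moreover have "continuous_on UNIV (\<lambda>x. frechet_derivative F (at x) v)"
    by (intro continuous_at_imp_continuous_on ballI has_derivative_continuous[OF Ck_on_2D(2)[OF F]])
  ultimately show "continuous_on UNIV (\<lambda>(t, x). lin_homotopy F a t x)"
    "continuous_on UNIV (\<lambda>(t, x). lin_homotopy' F a t x v)"
    unfolding lin_homotopy_def lin_homotopy'_def case_prod_beta'
    by (auto intro!: continuous_intros intro: continuous_on_compose2)
qed

text \<open>The whole homotopy has a single 1-jet at \<open>a\<close>, so transversality of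
  \<open>F\<close> to a stratum at \<open>a\<close> holds at all times at once.\<close>

lemma lin_homotopy_at: "lin_homotopy F a t a = F a" "lin_homotopy' F a t a = frechet_derivative F (at a)"
  using linear_0[OF has_derivative_linear[OF Ck_on_2D(1)[OF F]], of a]
  by (simp_all add: lin_homotopy_def lin_homotopy'_def linearization_def fun_eq_iff)

end

lemma lin_homotopy_01: "lin_homotopy F a 0 = F" "lin_homotopy F a 1 = linearization F a"
  by (simp_all add: lin_homotopy_def fun_eq_iff)

lemma transversal_at_cong:
  assumes "f x = g x" and "frechet_derivative f (at x) = frechet_derivative g (at x)"
  shows "transversal_at f M x \<longleftrightarrow> transversal_at g M x"
  using assms by (simp add: transversal_at_def)

section \<open>Uniform transversality along the homotopy\<close>

lemma not_eventually_prod_atD: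
  fixes z :: "'a::metric_space"
  assumes "\<not> (\<forall>\<^sub>F p in nhds z \<times>\<^sub>F at (0::real). Q p)" and "\<eta> > 0"
  obtains y \<epsilon> where "dist y z < \<eta>" "\<epsilon> \<noteq> 0" "\<bar>\<epsilon>\<bar> < \<eta>" "\<not> Q (y, \<epsilon>)"
proof -
  have "\<forall>\<^sub>F y in nhds z. dist y z < \<eta>" using assms(2) eventually_nhds_metric by blast
  moreover have "\<forall>\<^sub>F \<epsilon> in at (0::real). \<epsilon> \<noteq> 0 \<and> \<bar>\<epsilon>\<bar> < \<eta>"
    using assms(2) by (auto simp: eventually_at dist_real_def intro!: exI[of _ \<eta>])
  ultimately show thesis
    using assms(1) that unfolding eventually_prod_filter by blast
qed

text \<open>If this failed along \<open>(t\<^sub>n, x\<^sub>n, \<epsilon>\<^sub>n)\<close>, the \<open>C\<^sup>2\<close> map \<open>G\<close> with the 1-jet of \<open>F\<^bsub>t\<^sub>n\<^esub>\<close> at \<open>x\<^sub>n\<close>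
  and the 1-jet of \<open>F\<close> at \<open>a\<close> would violate property (T).\<close>

lemma homotopy_transversal:
  fixes F :: "'a::euclidean_space \<Rightarrow> 'b::euclidean_space" and V :: "real \<Rightarrow> 'b set"
  assumes T: "\<And>(G :: 'a \<Rightarrow> 'b) b. Ck_on 2 UNIV G \<Longrightarrow> strat_transversal_at G \<V> b \<Longrightarrow>
         \<exists>U \<epsilon>\<^sub>0. open U \<and> b \<in> U \<and> \<epsilon>\<^sub>0 > 0 \<and>
           (\<forall>\<epsilon>. 0 < \<bar>\<epsilon>\<bar> \<and> \<bar>\<epsilon>\<bar> < \<epsilon>\<^sub>0 \<longrightarrow> (\<forall>x\<in>U. transversal_at G (V \<epsilon>) x))"
    and disj: "\<forall>\<^sub>F \<epsilon> in at 0. F a \<notin> V \<epsilon>"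
    and F: "Ck_on 2 UNIV F" and tr: "strat_transversal_at F \<V> a"
  shows "\<forall>\<^sub>F p in nhds (t0, a) \<times>\<^sub>F at 0.
           transversal_at (lin_homotopy F a (fst (fst p))) (V (snd p)) (snd (fst p))"
    (is "eventually ?Q _")
proof (rule ccontr)
  assume neg: "\<not> eventually ?Q (nhds (t0, a) \<times>\<^sub>F at 0)"
  obtain e0 where e0: "e0 > 0" "\<And>\<epsilon>. \<epsilon> \<noteq> 0 \<Longrightarrow> \<bar>\<epsilon>\<bar> < e0 \<Longrightarrow> F a \<notin> V \<epsilon>"
    using disj by (auto simp: eventually_at dist_real_def)
  \<comment> \<open>At \<open>x = a\<close> every member of the homotopy takes the value
    \<open>F a\<close>, which is off \<open>V \<epsilon>\<close>, and transversality is vacuous.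
    Failures therefore occur at \<open>x \<noteq> a\<close>, as interpolation requires.\<close>
  have bad: "\<exists>t x \<epsilon>. \<bar>t - t0\<bar> < \<eta> \<and> x \<noteq> a \<and> norm (x - a) < \<eta> \<and> \<epsilon> \<noteq> 0 \<and> \<bar>\<epsilon>\<bar> < \<eta> \<and>
      \<not> transversal_at (lin_homotopy F a t) (V \<epsilon>) x" if "\<eta> > 0" for \<eta>
  proof -
    have "min \<eta> e0 > 0" using that e0(1) by simp
    from not_eventually_prod_atD[OF neg this] obtain p \<epsilon> where
      p: "dist p (t0, a) < min \<eta> e0" "\<epsilon> \<noteq> 0" "\<bar>\<epsilon>\<bar> < min \<eta> e0" "\<not> ?Q (p, \<epsilon>)" .
    obtain t x where tx: "p = (t, x)" by (cases p)
    have "\<bar>t - t0\<bar> < \<eta>" "norm (x - a) < \<eta>"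
      using p(1) dist_fst_le[of p "(t0, a)"] dist_snd_le[of p "(t0, a)"] by (auto simp: tx dist_norm)
    moreover have "x \<noteq> a"
      using p e0(2)[of \<epsilon>] lin_homotopy_at(1)[OF F] by (auto simp: tx transversal_at_def)
    ultimately show ?thesis using p by (auto simp: tx)
  qed
  \<comment> \<open>The rate for \<open>t\<close> becomes the summable weight of the interpolation.
    The bound 1/2 for \<open>x\<close> puts the ball of radius \<open>2 * norm (x - a)\<close> into
    the unit ball, where the Taylor bounds hold.\<close>
  define Ok where "Ok n s \<longleftrightarrow> (case s of (t, x, \<epsilon>) \<Rightarrow> \<bar>t - t0\<bar> < (1/2)^n \<and> x \<noteq> a \<and> norm (x - a) < 1/2 \<and>
      \<epsilon> \<noteq> 0 \<and> \<bar>\<epsilon>\<bar> < (1/2)^n \<and> \<not> transversal_at (lin_homotopy F a t) (V \<epsilon>) x)" for n :: nat and s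
  have "\<exists>s. \<forall>n. Ok n (s n) \<and> norm (fst (snd (s (Suc n))) - a) \<le> norm (fst (snd (s n)) - a) / 2"
  proof (rule dependent_nat_choice)
    show "\<exists>s. Ok 0 s" using bad[of "1/2"] by (force simp: Ok_def)
  next
    fix s n assume "Ok n s"
    then have "norm (fst (snd s) - a) / 2 > 0" by (auto simp: Ok_def)
    then have "min (min ((1/2)^Suc n) (1/2)) (norm (fst (snd s) - a) / 2) > 0" by simp
    from bad[OF this] show "\<exists>s'. Ok (Suc n) s' \<and> norm (fst (snd s') - a) \<le> norm (fst (snd s) - a) / 2"
      by (force simp: Ok_def)
  qed
  then obtain s where s: "\<And>n. Ok n (s n)"
    "\<And>n. norm (fst (snd (s (Suc n))) - a) \<le> norm (fst (snd (s n)) - a) / 2" by blast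
  define t x \<epsilon> where "t n = fst (s n)" and "x n = fst (snd (s n))" and "\<epsilon> n = snd (snd (s n))" for n
  have ok: "\<bar>t n - t0\<bar> < (1/2)^n" "x n \<noteq> a" "norm (x n - a) < 1/2" "\<epsilon> n \<noteq> 0" "\<bar>\<epsilon> n\<bar> < (1/2)^n"
    "\<not> transversal_at (lin_homotopy F a (t n)) (V (\<epsilon> n)) (x n)" for n
    using s(1)[of n] by (auto simp: Ok_def t_def x_def \<epsilon>_def split: prod.splits)
  have half: "norm (x (Suc n) - a) \<le> norm (x n - a) / 2" for n using s(2) by (simp add: x_def)
  define F' where "F' y = frechet_derivative F (at y)" for y
  define F'' where "F'' v y = frechet_derivative (\<lambda>y. F' y v) (at y)" for v y
  have D: "(F has_derivative F' y) (at y)" "((\<lambda>y. F' y v) has_derivative F'' v y) (at y)"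
    "continuous_on UNIV (\<lambda>y. F'' v y w)" for y v w
    using Ck_on_2D[OF F] by (simp_all add: F'_def F''_def)
  obtain B C where BC: "B \<ge> (1::real)" "\<And>v. C v \<ge> (0::real)"
    "\<And>y v w. y \<in> cball a 1 \<Longrightarrow> norm (F'' v y w) \<le> C v * norm w"
    "\<And>y v. y \<in> cball a 1 \<Longrightarrow> norm (F' a v - F' y v) \<le> B * norm (y - a) * norm v"
    "\<And>y. y \<in> cball a 1 \<Longrightarrow> norm (F a + F' a (y - a) - F y) \<le> B * (norm (y - a))\<^sup>2"
    using C2_taylor_bounds[OF D] by metis
  \<comment> \<open>This is the difference of the homotopy at times \<open>t n\<close> and
    \<open>t0\<close>; adding its jet at \<open>x n\<close> to the member at \<open>t0\<close>
    reproduces the failing jet.\<close>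
  define K where "K n y = (t n - t0) *\<^sub>R (linearization F a y - F y)" for n y
  define K' where "K' n y v = (t n - t0) *\<^sub>R (F' a v - F' y v)" for n y v
  define K'' where "K'' n v y w = (t n - t0) *\<^sub>R (0 - F'' v y w)" for n v y w
  have dK: "(K n has_derivative K' n y) (at y)" for n y
    unfolding K_def[abs_def] K'_def[abs_def]
    by (intro has_derivative_scaleR_right has_derivative_diff D(1))
       (use linearization_has_derivative[OF F] in \<open>simp add: F'_def\<close>)
  have dK': "((\<lambda>y. K' n y v) has_derivative K'' n v y) (at y)" for n v y
    unfolding K'_def K''_def[abs_def]
    by (intro has_derivative_scaleR_right has_derivative_diff has_derivative_const D(2))
  have cK: "continuous_on UNIV (\<lambda>y. K'' n v y w)" for n v w
    unfolding K''_def by (intro continuous_intros D(3))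
  have tn: "\<bar>t n - t0\<bar> \<le> 1 / 2 ^ n" for n using ok(1)[of n] by (simp add: power_divide)
  have near: "y \<in> cball a 1" if "norm (y - a) \<le> 2 * norm (x n - a)" for y n
    using that ok(3)[of n] by (simp add: dist_norm norm_minus_commute)
  \<comment> \<open>The 4 is the square of the 2 in the radius \<open>2 * norm (x n - a)\<close>.
    The two derivative bounds are relaxed to the same \<open>4 * B\<close>, as one constant must
    serve all three.\<close>
  have bK: "norm (K n y) \<le> 4 * B / 2 ^ n * (norm (x n - a))\<^sup>2"
    if "norm (y - a) \<le> 2 * norm (x n - a)" for n y
  proof -
    have "(norm (y - a))\<^sup>2 \<le> (2 * norm (x n - a))\<^sup>2" using that by (intro power_mono) auto
    then have "B * (norm (y - a))\<^sup>2 \<le> B * (4 * (norm (x n - a))\<^sup>2)"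
      using BC(1) by (intro mult_left_mono) (auto simp: power_mult_distrib)
    then have "norm (linearization F a y - F y) \<le> B * (4 * (norm (x n - a))\<^sup>2)"
      using BC(5)[OF near[OF that]] by (simp add: linearization_def F'_def)
    then have "norm (K n y) \<le> 1 / 2 ^ n * (B * (4 * (norm (x n - a))\<^sup>2))"
      unfolding K_def norm_scaleR real_norm_def using tn[of n] by (intro mult_mono') auto
    then show ?thesis by (simp add: mult_ac)
  qed
  have bK': "norm (K' n y v) \<le> 4 * B / 2 ^ n * norm (x n - a) * norm v"
    if "norm (y - a) \<le> 2 * norm (x n - a)" for n y v
  proof -
    have "norm (y - a) \<le> 4 * norm (x n - a)"
      using that norm_ge_zero[of "x n - a"] by linarith
    then have "B * norm (y - a) * norm v \<le> B * (4 * norm (x n - a)) * norm v"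
      using BC(1) by (intro mult_left_mono mult_right_mono) auto
    then have "norm (F' a v - F' y v) \<le> B * (4 * norm (x n - a)) * norm v"
      using BC(4)[OF near[OF that], of v] by simp
    then have "norm (K' n y v) \<le> 1 / 2 ^ n * (B * (4 * norm (x n - a)) * norm v)"
      unfolding K'_def norm_scaleR real_norm_def using tn[of n] by (intro mult_mono') auto
    then show ?thesis by (simp add: mult_ac)
  qed
  have bK'': "norm (K'' n v y w) \<le> C v * (4 * B / 2 ^ n) * norm w"
    if "norm (y - a) \<le> 2 * norm (x n - a)" for n v y w
  proof -
    have "norm (K'' n v y w) \<le> 1 / 2 ^ n * (C v * norm w)"
      unfolding K''_def norm_scaleR real_norm_def
      using tn[of n] BC(3)[OF near[OF that], of v w] by (intro mult_mono') auto
    also have "\<dots> \<le> (4 * B / 2 ^ n) * (C v * norm w)"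
      using BC(1,2) by (intro mult_right_mono divide_right_mono) auto
    finally show ?thesis by (simp add: mult_ac)
  qed
  have "4 * B \<ge> 0" using BC(1) by simp
  from C2_interpolation[OF ok(2) half BC(2) dK dK' cK bK bK' bK'' this]
  obtain H where H: "Ck_on 2 UNIV H" "H a = 0" "(H has_derivative (\<lambda>_. 0)) (at a)"
    "\<And>n. H (x n) = K n (x n)" "\<And>n. (H has_derivative K' n (x n)) (at (x n))" by blast
  define G where "G y = lin_homotopy F a t0 y + H y" for y
  have G2: "Ck_on 2 UNIV G"
    unfolding G_def[abs_def] by (intro Ck_on_2_add Ck_on_2_lin_homotopy F H)
  have "(G has_derivative (\<lambda>v. lin_homotopy' F a t0 a v + 0)) (at a)"
    unfolding G_def[abs_def] by (intro has_derivative_add lin_homotopy_has_derivative F H(3))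
  then have "frechet_derivative G (at a) = frechet_derivative F (at a)"
    using frechet_derivative_at lin_homotopy_at(2)[OF F] by fastforce
  moreover have "G a = F a" using H(2) lin_homotopy_at(1)[OF F] by (simp add: G_def)
  ultimately have "strat_transversal_at G \<V> a"
    using tr transversal_at_cong unfolding strat_transversal_at_def by blast
  from T[OF G2 this] obtain U \<epsilon>\<^sub>0 where U: "open U" "a \<in> U" "\<epsilon>\<^sub>0 > 0"
    "\<And>\<epsilon> x. 0 < \<bar>\<epsilon>\<bar> \<Longrightarrow> \<bar>\<epsilon>\<bar> < \<epsilon>\<^sub>0 \<Longrightarrow> x \<in> U \<Longrightarrow> transversal_at G (V \<epsilon>) x" by metis
  obtain \<delta> where \<delta>: "\<delta> > 0" "ball a \<delta> \<subseteq> U" using U(1,2) open_contains_ball by metis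
  have xn: "norm (x n - a) \<le> (1/2) ^ n" for n
  proof (induction n)
    case 0
    show ?case using ok(3)[of 0] by simp
  next
    case (Suc n)
    then show ?case using half[of n] by simp
  qed
  obtain n where n: "(1/2::real) ^ n < min \<delta> \<epsilon>\<^sub>0"
    using real_arch_pow_inv[of "min \<delta> \<epsilon>\<^sub>0" "1/2"] \<delta>(1) U(3) by auto
  have "x n \<in> U" using xn[of n] n \<delta>(2) by (auto simp: dist_norm norm_minus_commute)
  then have trG: "transversal_at G (V (\<epsilon> n)) (x n)" using U(4)[of "\<epsilon> n"] ok(4,5)[of n] n by auto
  have Gx: "G (x n) = lin_homotopy F a (t n) (x n)"
    by (simp add: G_def H(4) K_def lin_homotopy_def algebra_simps)
  have "(G has_derivative (\<lambda>v. lin_homotopy' F a t0 (x n) v + K' n (x n) v)) (at (x n))"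
    unfolding G_def[abs_def] by (intro has_derivative_add lin_homotopy_has_derivative F H(5))
  moreover have "(\<lambda>v. lin_homotopy' F a t0 (x n) v + K' n (x n) v) = lin_homotopy' F a (t n) (x n)"
    by (simp add: fun_eq_iff lin_homotopy'_def K'_def F'_def algebra_simps)
  ultimately have "frechet_derivative G (at (x n)) = frechet_derivative (lin_homotopy F a (t n)) (at (x n))"
    using frechet_derivative_at frechet_lin_homotopy[OF F] by metis
  with trG Gx ok(6)[of n] show False using transversal_at_cong by blast
qed

section \<open>Limit points of the nearby fibres\<close>

text \<open>The negation says that \<open>z\<close> is a limit of points of
  \<open>V \<epsilon>\<close> as \<epsilon> tends to 0. The filter \<open>at 0\<close> leaves out
  the fibre over 0 itself, so points of \<open>V 0\<close> may well be avoided.\<close>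

definition avoids :: "(real \<Rightarrow> 'b::topological_space set) \<Rightarrow> 'b \<Rightarrow> bool" where
  "avoids V z \<longleftrightarrow> (\<forall>\<^sub>F p in nhds z \<times>\<^sub>F at 0. fst p \<notin> V (snd p))"

lemma eventually_avoids:
  assumes "avoids V z"
  shows "\<forall>\<^sub>F y in nhds z. avoids V y"
proof -
  obtain Pf Pg where P: "eventually Pf (nhds z)" "eventually Pg (at 0)"
    "\<And>x y. Pf x \<Longrightarrow> Pg y \<Longrightarrow> x \<notin> V y"
    using assms unfolding avoids_def eventually_prod_filter by auto
  have "\<forall>\<^sub>F y in nhds z. eventually Pf (nhds y)" using P(1) by (simp add: eventually_eventually)
  then show ?thesis
  proof eventually_elim
    case (elim y)
    then show ?case using P unfolding avoids_def eventually_prod_filter by fastforce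
  qed
qed

lemma transversal_at_dim:
  fixes f :: "'a::euclidean_space \<Rightarrow> 'b::euclidean_space"
  assumes M: "smooth_submanifold d M" and "f x \<in> M" and "transversal_at f M x"
    and df: "(f has_derivative f') (at x)"
  shows "DIM('b) \<le> dim (range f') + d"
proof -
  let ?T = "tangent_space M (f x)"
  have f': "frechet_derivative f (at x) = f'" using frechet_derivative_at[OF df] by simp
  have T: "subspace ?T" "dim ?T = d" using tangent_space_dim[OF M assms(2)] by auto
  have R: "subspace (range f')"
    using linear_subspace_image[OF has_derivative_linear[OF df] subspace_UNIV] .
  have "{u + w |u w. u \<in> range f' \<and> w \<in> ?T} = UNIV"
    using assms(2,3) f' by (simp add: transversal_at_def)
  then show ?thesis
    using dim_sums_Int[OF R T(1)] T(2) by (simp add: image_def)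
qed

text \<open>A map of rank one suffices to be transversal to a stratum of codimension at most one. If \<open>z\<close>
  is a limit of points \<open>y\<^sub>n\<close> of \<open>V\<^sub>\<epsilon>\<close>, such a map can be bent to pass through the \<open>y\<^sub>n\<close> while
  keeping rank one there, where it is not transversal to a manifold of codimension two.\<close>

lemma big_stratum_avoids:
  fixes V :: "real \<Rightarrow> (real ^ 'n) set" and \<V> :: "(real ^ 'n) set set"
  assumes T: "\<And>(G :: real ^ 2 \<Rightarrow> real ^ 'n) b. Ck_on 2 UNIV G \<Longrightarrow> strat_transversal_at G \<V> b \<Longrightarrow>
         \<exists>U \<epsilon>\<^sub>0. open U \<and> b \<in> U \<and> \<epsilon>\<^sub>0 > 0 \<and>
           (\<forall>\<epsilon>. 0 < \<bar>\<epsilon>\<bar> \<and> \<bar>\<epsilon>\<bar> < \<epsilon>\<^sub>0 \<longrightarrow> (\<forall>x\<in>U. transversal_at G (V \<epsilon>) x))"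
    and n: "CARD('n) > 2"
    and V: "\<forall>\<^sub>F \<epsilon> in at 0. smooth_submanifold (CARD('n) - 2) (V \<epsilon>)"
    and disj: "disjoint \<V>" and S: "S \<in> \<V>" "z \<in> S" "smooth_submanifold d S" "CARD('n) \<le> d + 1"
  shows "avoids V z"
proof (rule ccontr)
  assume neg: "\<not> avoids V z"
  obtain e0 where e0: "e0 > 0" "\<And>\<epsilon>. \<epsilon> \<noteq> 0 \<Longrightarrow> \<bar>\<epsilon>\<bar> < e0 \<Longrightarrow> smooth_submanifold (CARD('n) - 2) (V \<epsilon>)"
    using V by (auto simp: eventually_at dist_real_def)
  \<comment> \<open>The bound is the interpolation weight \<open>1 / 2 ^ n\<close> times the squared
    radius, for nodes at distance \<open>(1/2)^n\<close> from the origin.\<close>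
  have "\<exists>y \<epsilon>. norm (y - z) < (1/2)^n * ((1/2)^n)\<^sup>2 \<and> \<epsilon> \<noteq> 0 \<and> \<bar>\<epsilon>\<bar> < (1/2)^n \<and> \<bar>\<epsilon>\<bar> < e0 \<and> y \<in> V \<epsilon>"
    for n :: nat
  proof -
    have "min (min ((1/2)^n * ((1/2)^n)\<^sup>2) ((1/2)^n)) e0 > 0" using e0(1) by simp
    from not_eventually_prod_atD[OF neg[unfolded avoids_def] this]
    show ?thesis by (metis dist_norm fst_conv min_less_iff_conj snd_conv)
  qed
  then obtain y \<epsilon> where y: "\<And>n. norm (y n - z) < (1/2)^n * ((1/2)^n)\<^sup>2"
    "\<And>n. \<epsilon> n \<noteq> 0" "\<And>n. \<bar>\<epsilon> n\<bar> < (1/2)^n" "\<And>n. \<bar>\<epsilon> n\<bar> < e0" "\<And>n. y n \<in> V (\<epsilon> n)"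
    by metis
  \<comment> \<open>The nodes lie on the second axis, where the linear part of \<open>G\<close>
    below, a function of the first coordinate, vanishes. Interpolating constants there gives
    \<open>G (x n) = y n\<close> without changing the derivative.\<close>
  define x :: "nat \<Rightarrow> real ^ 2" where "x n = (1/2)^n *\<^sub>R axis 2 1" for n
  have nx: "norm (x n - 0) = (1/2)^n" for n by (simp add: x_def)
  have x1: "x n $ 1 = 0" for n by (simp add: x_def axis_def)
  have "x n \<noteq> 0" for n by (simp add: x_def axis_eq_0_iff)
  moreover have "norm (x (Suc n) - 0) \<le> norm (x n - 0) / 2" for n unfolding nx by simp
  moreover have "norm (y n - z) \<le> 1 / 2 ^ n * (norm (x n - 0))\<^sup>2" for n
    using y(1)[of n] unfolding nx by (simp add: power_divide)
  ultimately have "\<exists>H. Ck_on 2 UNIV H \<and> H 0 = 0 \<and> (H has_derivative (\<lambda>_. 0)) (at 0) \<and>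
    (\<forall>n. H (x n) = y n - z \<and> (H has_derivative (\<lambda>_. 0)) (at (x n)))"
    by (intro C2_interpolation[where K = "\<lambda>n _. y n - z" and K' = "\<lambda>_ _ _. 0" and K'' = "\<lambda>_ _ _ _. 0"
          and B = 1 and C = "\<lambda>_. 0"]) auto
  then obtain H where H: "Ck_on 2 UNIV H" "H 0 = 0" "(H has_derivative (\<lambda>_. 0)) (at 0)"
    "\<And>n. H (x n) = y n - z" "\<And>n. (H has_derivative (\<lambda>_. 0)) (at (x n))" by blast
  have Tz: "subspace (tangent_space S z)" "dim (tangent_space S z) = d"
    using tangent_space_dim[OF S(3,2)] by auto
  \<comment> \<open>The tangent space has codimension at most one, so a single direction
    \<open>v\<close> completes it; if it is everything, any \<open>v\<close> will do.\<close>
  obtain v where v: "\<And>w. \<exists>c. w - c *\<^sub>R v \<in> tangent_space S z"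
  proof (cases "tangent_space S z = UNIV")
    case True
    then show ?thesis using that by blast
  next
    case False
    then obtain v where v: "v \<notin> tangent_space S z" by blast
    then have "dim (insert v (tangent_space S z)) = d + 1"
      using Tz by (simp add: dim_insert span_eq_iff[THEN iffD2])
    then have "DIM(real ^ 'n) \<le> dim (insert v (tangent_space S z))" using S(4) by simp
    then have "dim (insert v (tangent_space S z)) = DIM(real ^ 'n)"
      using dim_subset_UNIV[of "insert v (tangent_space S z)"] by linarith
    then have "span (insert v (tangent_space S z)) = UNIV" using dim_eq_full by blast
    then have "\<exists>c. w - c *\<^sub>R v \<in> tangent_space S z" for w
      using span_breakdown_eq[of w v "tangent_space S z"] Tz(1) by (metis UNIV_I span_eq_iff)
    then show ?thesis using that by blast
  qed
  define G where "G p = (z + (p $ 1) *\<^sub>R v) + H p" for p :: "real ^ 2"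
  have d1: "((\<lambda>p. z + (p $ 1) *\<^sub>R v) has_derivative (\<lambda>w. (w $ 1) *\<^sub>R v)) (at p)" for p :: "real ^ 2"
    by (auto intro!: derivative_eq_intros bounded_linear_imp_has_derivative bounded_linear_vec_nth)
  have "Ck_on 2 UNIV (\<lambda>p :: real ^ 2. z + (p $ 1) *\<^sub>R v)"
    by (rule Ck_on_2I[OF d1 has_derivative_const]) simp
  then have G2: "Ck_on 2 UNIV G" unfolding G_def[abs_def] by (rule Ck_on_2_add[OF _ H(1)])
  have dG: "(G has_derivative (\<lambda>w. (w $ 1) *\<^sub>R v)) (at p)" if "(H has_derivative (\<lambda>_. 0)) (at p)" for p
    unfolding G_def[abs_def] using has_derivative_add[OF d1 that] by simp
  have G0: "G 0 = z" by (simp add: G_def H(2))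
  have "transversal_at G R 0" if "R \<in> \<V>" for R
  proof (cases "z \<in> R")
    case True
    then have "R = S" using disj S(1,2) that by (auto simp: disjoint_def)
    have "w \<in> {u + w' |u w'. u \<in> range (\<lambda>w :: real ^ 2. (w $ 1) *\<^sub>R v) \<and> w' \<in> tangent_space S z}" for w
    proof -
      obtain c where c: "w - c *\<^sub>R v \<in> tangent_space S z" using v by blast
      have "c *\<^sub>R v \<in> range (\<lambda>w :: real ^ 2. (w $ 1) *\<^sub>R v)"
        by (rule range_eqI[of _ _ "vec c"]) simp
      moreover have "w = c *\<^sub>R v + (w - c *\<^sub>R v)" by simp
      ultimately show ?thesis using c by blast
    qed
    then have "{u + w' |u w'. u \<in> range (\<lambda>w :: real ^ 2. (w $ 1) *\<^sub>R v) \<and> w' \<in> tangent_space S z} = UNIV"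
      by blast
    then show ?thesis
      unfolding transversal_at_def frechet_derivative_at[OF dG[OF H(3)], symmetric] G0 \<open>R = S\<close> by blast
  next
    case False
    then show ?thesis by (simp add: transversal_at_def G0)
  qed
  then have "strat_transversal_at G \<V> 0" by (simp add: strat_transversal_at_def)
  from T[OF G2 this] obtain U \<epsilon>\<^sub>0 where U: "open U" "0 \<in> U" "\<epsilon>\<^sub>0 > 0"
    "\<And>\<epsilon> x. 0 < \<bar>\<epsilon>\<bar> \<Longrightarrow> \<bar>\<epsilon>\<bar> < \<epsilon>\<^sub>0 \<Longrightarrow> x \<in> U \<Longrightarrow> transversal_at G (V \<epsilon>) x" by metis
  obtain \<delta> where \<delta>: "\<delta> > 0" "ball 0 \<delta> \<subseteq> U" using U(1,2) open_contains_ball by metis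
  obtain n where n': "(1/2::real) ^ n < min \<delta> \<epsilon>\<^sub>0"
    using real_arch_pow_inv[of "min \<delta> \<epsilon>\<^sub>0" "1/2"] \<delta>(1) U(3) by auto
  have "x n \<in> U" using nx[of n] n' \<delta>(2) by (auto simp: dist_norm norm_minus_commute)
  then have "transversal_at G (V (\<epsilon> n)) (x n)" using U(4)[of "\<epsilon> n"] y(2,3)[of n] n' by auto
  moreover have "G (x n) \<in> V (\<epsilon> n)" using y(5)[of n] by (simp add: G_def x1 H(4))
  \<comment> \<open>Rank at most one plus dimension \<open>CARD('n) - 2\<close> falls one short of
    \<open>CARD('n)\<close>; \<open>CARD('n) > 2\<close> ensures that the subtraction is not
    truncated.\<close>
  ultimately have "DIM(real ^ 'n) \<le> dim (range (\<lambda>w :: real ^ 2. (w $ 1) *\<^sub>R v)) + (CARD('n) - 2)"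
    by (intro transversal_at_dim[OF e0(2)[OF y(2,4)] _ _ dG[OF H(5)]])
  moreover have "dim (range (\<lambda>w :: real ^ 2. (w $ 1) *\<^sub>R v)) \<le> card {v}"
    by (rule dim_le_card) (auto intro: span_scale span_base)
  ultimately show False using n by simp
qed

section \<open>Counting solutions along the homotopy\<close>

text \<open>For times near \<open>t\<close>, sending a solution at time \<open>t\<close> to the only
  solution in a small ball about it is a bijection: injective because the balls are far enough
  apart, surjective because no solution appears in the compact rest of the closed ball. So the count
  is locally constant on a connected interval.\<close>

lemma solutions_card_const:
  fixes f :: "real \<Rightarrow> 'a::euclidean_space \<Rightarrow> 'b::euclidean_space"
  assumes M: "smooth_submanifold d M" "DIM('b) = d + DIM('a)" "closed M"
    and df: "\<And>t x. (f t has_derivative f' t x) (at x)"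
    and cf: "continuous_on UNIV (\<lambda>(t, x). f t x)"
    and cf': "\<And>v. continuous_on UNIV (\<lambda>(t, x). f' t x v)"
    and tr: "\<And>t x. t \<in> {0..1} \<Longrightarrow> x \<in> cball a r \<Longrightarrow> transversal_at (f t) M x"
    and bd: "\<And>t x. t \<in> {0..1} \<Longrightarrow> x \<in> sphere a r \<Longrightarrow> f t x \<notin> M"
  shows "finite {x \<in> ball a r. f 0 x \<in> M}" and "finite {x \<in> ball a r. f 1 x \<in> M}"
    and "card {x \<in> ball a r. f 0 x \<in> M} = card {x \<in> ball a r. f 1 x \<in> M}"
proof -
  define Z where "Z t = {x \<in> ball a r. f t x \<in> M}" for t
  \<comment> \<open>Solutions are counted in the open ball, but compactness arguments need the
    closed one; the boundary condition identifies the two.\<close>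
  have Zc: "Z t = {x \<in> cball a r. f t x \<in> M}" if "t \<in> {0..1}" for t
    using bd[OF that] by (auto simp: Z_def less_le)
  have isC: "isCont (\<lambda>(t, x). f t x) p" for p
    using cf continuous_on_eq_continuous_at[OF open_UNIV] by blast
  have cft: "continuous_on S (f t)" for t S
    by (intro continuous_at_imp_continuous_on ballI has_derivative_continuous[OF df])
  define uniq where "uniq t x \<rho> \<longleftrightarrow> (\<forall>\<^sub>F t' in nhds t. \<exists>!x'. x' \<in> cball x \<rho> \<and> f t' x' \<in> M)" for t x \<rho>
  have LL: "\<exists>\<rho>0>0. \<forall>\<rho>. 0 < \<rho> \<and> \<rho> \<le> \<rho>0 \<longrightarrow> uniq t x \<rho>"
    if "t \<in> {0..1}" "x \<in> Z t" for t x
    unfolding uniq_def using that by (intro local_unique_solution[OF M(1,2) df cf cf']) (auto simp: Z_def intro: tr)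
  have fin: "finite (Z t)" if t: "t \<in> {0..1}" for t
  proof -
    have "closed (cball a r \<inter> f t -` M)"
      by (rule continuous_closed_preimage[OF cft closed_cball M(3)])
    then have "compact (cball a r \<inter> (cball a r \<inter> f t -` M))"
      by (intro compact_Int_closed compact_cball)
    moreover have "cball a r \<inter> (cball a r \<inter> f t -` M) = Z t" by (auto simp: Zc[OF t])
    ultimately have comp: "compact (Z t)" by simp
    have "\<exists>\<rho>>0. \<forall>y\<in>Z t. dist x y \<le> \<rho> \<longrightarrow> y = x" if x: "x \<in> Z t" for x
    proof -
      obtain \<rho> where \<rho>: "\<rho> > 0" "uniq t x \<rho>"
        using LL[OF t x] by (metis order_refl)
      \<comment> \<open>\<open>nhds t\<close> includes the time \<open>t\<close> itself, so
        uniqueness already holds there: solutions are isolated, and a compact set of isolated points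
        is finite.\<close>
      have "\<exists>!x'. x' \<in> cball x \<rho> \<and> f t x' \<in> M"
        using \<rho>(2) unfolding uniq_def by (rule eventually_nhds_x_imp_x)
      then show ?thesis
        using \<rho>(1) x by (intro exI[of _ \<rho>]) (auto simp: Z_def)
    qed
    then obtain \<rho> where \<rho>: "\<And>x. x \<in> Z t \<Longrightarrow> \<rho> x > 0"
      "\<And>x y. x \<in> Z t \<Longrightarrow> y \<in> Z t \<Longrightarrow> dist x y \<le> \<rho> x \<Longrightarrow> y = x" by metis
    have "Z t \<subseteq> (\<Union>x\<in>Z t. ball x (\<rho> x))" using \<rho>(1) by force
    then obtain C where "C \<subseteq> Z t" "finite C" "Z t \<subseteq> (\<Union>x\<in>C. ball x (\<rho> x))"
      using compactE_image[OF comp, of "Z t" "\<lambda>x. ball x (\<rho> x)"] by auto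
    then have "Z t \<subseteq> C" using \<rho>(2) by force
    then show ?thesis using \<open>finite C\<close> finite_subset by blast
  qed
  have loc: "\<forall>\<^sub>F t' in nhds t. t' \<in> {0..1} \<longrightarrow> card (Z t') = card (Z t)" if t: "t \<in> {0..1}" for t
  proof -
    obtain \<rho>0 where \<rho>0: "\<And>x. x \<in> Z t \<Longrightarrow> \<rho>0 x > 0"
      "\<And>x \<rho>. x \<in> Z t \<Longrightarrow> 0 < \<rho> \<Longrightarrow> \<rho> \<le> \<rho>0 x \<Longrightarrow> uniq t x \<rho>"
      using LL[OF t] by metis
    have small: "\<forall>\<^sub>F \<rho> in at_right 0. \<rho> < c" if "c > 0" for c :: real
      using that eventually_at_right_real by (metis (mono_tags, lifting) eventually_mono greaterThanLessThan_iff)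
    \<comment> \<open>One radius for all solutions: below their uniqueness radii, below their
      distances to the sphere so that continued solutions stay inside, and below half their mutual
      distances so that different solutions have different continuations.\<close>
    have "\<forall>\<^sub>F \<rho> in at_right 0. 0 < \<rho> \<and> (\<forall>x\<in>Z t. \<rho> < \<rho>0 x \<and> \<rho> < r - dist a x \<and>
        (\<forall>y\<in>Z t - {x}. \<rho> < dist x y / 2))"
      using fin[OF t] \<rho>0(1)
      by (intro eventually_conj eventually_ball_finite ballI small eventually_at_right_less)
         (auto simp: Z_def)
    then obtain \<rho> where \<rho>: "\<rho> > 0" "\<And>x. x \<in> Z t \<Longrightarrow> \<rho> < \<rho>0 x" "\<And>x. x \<in> Z t \<Longrightarrow> \<rho> < r - dist a x"
      "\<And>x y. x \<in> Z t \<Longrightarrow> y \<in> Z t \<Longrightarrow> x \<noteq> y \<Longrightarrow> \<rho> < dist x y / 2"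
      using eventually_happens'[OF trivial_limit_at_right_real] by blast
    define K where "K = cball a r - (\<Union>x\<in>Z t. ball x \<rho>)"
    have "compact K" unfolding K_def by (intro compact_diff compact_cball open_UN) auto
    have "\<forall>\<^sub>F t' in nhds t. \<forall>y\<in>K. f (snd (y, t')) (fst (y, t')) \<notin> M"
    proof (rule eventually_compact[OF \<open>compact K\<close>])
      fix y assume "y \<in> K"
      then have "f t y \<notin> M" using \<rho>(1) by (auto simp: K_def Zc[OF t])
      moreover have "isCont (\<lambda>p. (\<lambda>(t, x). f t x) (snd p, fst p)) (y, t)"
        by (intro isCont_o2[OF _ isC] continuous_intros)
      then have "((\<lambda>p. f (snd p) (fst p)) \<longlongrightarrow> f t y) (nhds (y, t))"
        by (auto dest: isCont_tendsto_nhds)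
      ultimately show "\<forall>\<^sub>F p in nhds y \<times>\<^sub>F nhds t. f (snd p) (fst p) \<notin> M"
        using topological_tendstoD[of _ _ _ "- M"] M(3) by (fastforce simp: nhds_prod open_Compl)
    qed
    moreover have "\<forall>\<^sub>F t' in nhds t. \<forall>x\<in>Z t. \<exists>!x'. x' \<in> cball x \<rho> \<and> f t' x' \<in> M"
    proof (intro eventually_ball_finite fin t ballI)
      fix x assume x: "x \<in> Z t"
      from \<rho>0(2)[OF x \<rho>(1) less_imp_le[OF \<rho>(2)[OF x]]]
      show "\<forall>\<^sub>F t' in nhds t. \<exists>!x'. x' \<in> cball x \<rho> \<and> f t' x' \<in> M" by (simp only: uniq_def)
    qed
    ultimately show ?thesis
    proof eventually_elim
      case (elim t')
      show ?case
      proof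
        assume t': "t' \<in> {0..1}"
        obtain g where g: "\<And>x. x \<in> Z t \<Longrightarrow> g x \<in> cball x \<rho> \<and> f t' (g x) \<in> M"
          "\<And>x x'. x \<in> Z t \<Longrightarrow> x' \<in> cball x \<rho> \<Longrightarrow> f t' x' \<in> M \<Longrightarrow> x' = g x"
          using elim(2) by metis
        have "bij_betw g (Z t) (Z t')"
        proof (intro bij_betw_imageI inj_onI equalityI subsetI)
          fix x y assume xy: "x \<in> Z t" "y \<in> Z t" "g x = g y"
          have "dist x (g x) \<le> \<rho>" "dist y (g x) \<le> \<rho>" using g(1)[OF xy(1)] g(1)[OF xy(2)] xy(3) by auto
          then have "dist x y \<le> 2 * \<rho>" using dist_triangle2[of x y "g x"] by linarith
          then show "x = y" using \<rho>(4)[OF xy(1,2)] by force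
        next
          fix x' assume "x' \<in> g ` Z t"
          then obtain x where x: "x \<in> Z t" "x' = g x" by blast
          then have "dist a x' \<le> dist a x + \<rho>" using g(1)[OF x(1)] dist_triangle[of a x' x] by auto
          then show "x' \<in> Z t'" using g(1)[OF x(1)] x \<rho>(3)[OF x(1)] by (auto simp: Z_def)
        next
          fix x' assume x': "x' \<in> Z t'"
          then have "x' \<notin> K" using elim(1) by (auto simp: Z_def)
          then obtain x where "x \<in> Z t" "x' \<in> ball x \<rho>" using x' by (auto simp: K_def Z_def)
          then show "x' \<in> g ` Z t" using g(2)[of x x'] x' by (auto simp: Z_def)
        qed
        then show "card (Z t') = card (Z t)" by (metis bij_betw_same_card)
      qed
    qed
  qed
  have "(\<lambda>t. card (Z t)) constant_on {0..1::real}"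
  proof (rule locally_constant_imp_constant)
    fix t :: real assume t: "t \<in> {0..1}"
    obtain W where W: "open W" "t \<in> W" "\<And>t'. t' \<in> W \<Longrightarrow> t' \<in> {0..1} \<Longrightarrow> card (Z t') = card (Z t)"
      using loc[OF t] unfolding eventually_nhds by blast
    show "\<exists>T. openin (top_of_set {0..1}) T \<and> t \<in> T \<and> (\<forall>x\<in>T. card (Z x) = card (Z t))"
      using openin_open_Int[OF W(1), of "{0..1}"] t W(2,3)
      by (intro exI[of _ "{0..1} \<inter> W"]) blast
  qed simp
  then obtain c where "\<And>t. t \<in> {0..1} \<Longrightarrow> card (Z t) = c" unfolding constant_on_def by blast
  then have "card (Z 0) = card (Z 1)" by simp
  then show "finite {x \<in> ball a r. f 0 x \<in> M}" "finite {x \<in> ball a r. f 1 x \<in> M}"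
    "card {x \<in> ball a r. f 0 x \<in> M} = card {x \<in> ball a r. f 1 x \<in> M}"
    using fin[of 0] fin[of 1] by (simp_all add: Z_def)
qed

section \<open>Isolation of the limit point at \<open>a\<close>\<close>

text \<open>Only the case that \<open>F a\<close> is a limit point has content. Its stratum
  \<open>S\<close> has codimension at most 2, because a map from the plane is transversal to it, and
  at least 2, because larger strata carry no limit points. The strata that could still interfere
  have dimension at most that of \<open>S\<close>, and the frontier condition keeps those away from
  \<open>F a\<close>.\<close>

lemma homotopy_avoids_punctured:
  fixes F :: "real ^ 2 \<Rightarrow> real ^ 'n" and V :: "real \<Rightarrow> (real ^ 'n) set" and \<V> :: "(real ^ 'n) set set"
  assumes T: "\<And>(G :: real ^ 2 \<Rightarrow> real ^ 'n) b. Ck_on 2 UNIV G \<Longrightarrow> strat_transversal_at G \<V> b \<Longrightarrow>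
         \<exists>U \<epsilon>\<^sub>0. open U \<and> b \<in> U \<and> \<epsilon>\<^sub>0 > 0 \<and>
           (\<forall>\<epsilon>. 0 < \<bar>\<epsilon>\<bar> \<and> \<bar>\<epsilon>\<bar> < \<epsilon>\<^sub>0 \<longrightarrow> (\<forall>x\<in>U. transversal_at G (V \<epsilon>) x))"
    and n: "CARD('n) > 2"
    and V: "\<forall>\<^sub>F \<epsilon> in at 0. smooth_submanifold (CARD('n) - 2) (V \<epsilon>)"
    and off: "\<And>z. z \<notin> V 0 \<Longrightarrow> avoids V z"
    and strat: "stratification (V 0) \<V>"
    and F: "Ck_on 2 UNIV F" and tr: "strat_transversal_at F \<V> a"
  shows "\<forall>\<^sub>F x in nhds a. \<forall>t\<in>{0..1}. x = a \<or> avoids V (lin_homotopy F a t x)"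
proof -
  have part: "\<Union>\<V> = V 0" "disjoint \<V>"
    using strat by (auto simp: stratification_def partition_on_def)
  have "\<exists>dm. (\<forall>S\<in>\<V>. smooth_submanifold (dm S) S) \<and>
      (\<forall>S\<in>\<V>. \<exists>\<C>\<subseteq>\<V>. closure S \<inter> V 0 = S \<union> \<Union>\<C> \<and> (\<forall>R\<in>\<C>. dm R < dm S))"
    using strat by (simp only: stratification_def)
  then obtain dm where dm0: "\<forall>S\<in>\<V>. smooth_submanifold (dm S) S"
    and fr0: "\<forall>S\<in>\<V>. \<exists>\<C>\<subseteq>\<V>. closure S \<inter> V 0 = S \<union> \<Union>\<C> \<and> (\<forall>R\<in>\<C>. dm R < dm S)"
    by (elim exE conjE) (rule that)
  note dm = bspec[OF dm0] and fr = bspec[OF fr0]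
  have big: "avoids V z" if "S \<in> \<V>" "z \<in> S" "CARD('n) \<le> dm S + 1" for S z
    using big_stratum_avoids[OF T n V part(2) that(1,2) dm[OF that(1)] that(3)] .
  have tend: "((\<lambda>p. lin_homotopy F a (fst p) (snd p)) \<longlongrightarrow> F a) (nhds (t0, a))" for t0
  proof -
    have "isCont (\<lambda>p. lin_homotopy F a (fst p) (snd p)) (t0, a)"
      using continuous_on_lin_homotopy[OF F, of a] continuous_on_eq_continuous_at[OF open_UNIV]
      unfolding case_prod_beta' by blast
    then show ?thesis by (auto dest!: isCont_tendsto_nhds simp: lin_homotopy_at[OF F])
  qed
  have "\<forall>\<^sub>F p in nhds (t0, a). snd p = a \<or> avoids V (lin_homotopy F a (fst p) (snd p))" for t0
  proof (cases "avoids V (F a)")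
    case True
    have "\<forall>\<^sub>F p in nhds (t0, a). avoids V (lin_homotopy F a (fst p) (snd p))"
      using eventually_avoids[OF True] tend[of t0] by (auto simp: filterlim_iff)
    then show ?thesis by eventually_elim simp
  next
    case False
    then have "F a \<in> V 0" using off by blast
    then obtain S where S: "S \<in> \<V>" "F a \<in> S" using part(1) by blast
    have dF: "(F has_derivative frechet_derivative F (at a)) (at a)" by (rule Ck_on_2D(1)[OF F])
    have trS: "transversal_at F S a" using tr S(1) by (simp add: strat_transversal_at_def)
    have "dim (range (frechet_derivative F (at a))) \<le> DIM(real ^ 2)"
      using dim_image_le[OF has_derivative_linear[OF dF], of UNIV] by simp
    then have "CARD('n) \<le> dm S + 2"
      using transversal_at_dim[of "dm S" S F a, OF dm[OF S(1)] S(2) trS dF] by simp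
    moreover have "\<not> CARD('n) \<le> dm S + 1" using big[OF S] False by blast
    ultimately have dS: "CARD('n) = dm S + 2" by simp
    obtain N where N: "openin (top_of_set (V 0)) N" "F a \<in> N" "finite {R \<in> \<V>. R \<inter> N \<noteq> {}}"
      using strat \<open>F a \<in> V 0\<close> unfolding stratification_def locally_finite_in_def by auto
    obtain N' where N': "open N'" "N = V 0 \<inter> N'" using N(1) by (auto simp: openin_open)
    \<comment> \<open>The strata to be kept away: those meeting \<open>N\<close> that are neither
      \<open>S\<close> nor large enough for \<open>big\<close>. Local finiteness makes them finitely
      many, so that their closures can be avoided simultaneously.\<close>
    define Bd where "Bd = {R \<in> \<V>. R \<inter> N \<noteq> {} \<and> R \<noteq> S \<and> dm R \<le> dm S}"
    have "finite Bd" unfolding Bd_def by (rule finite_subset[OF _ N(3)]) auto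
    \<comment> \<open>Otherwise \<open>S\<close>, being the stratum that contains
      \<open>F a\<close>, would be one of the frontier strata of \<open>R\<close> and have strictly
      smaller dimension than \<open>R\<close>, against \<open>dm R \<le> dm S\<close>.\<close>
    have "F a \<notin> closure R" if R: "R \<in> Bd" for R
    proof
      assume "F a \<in> closure R"
      obtain \<C> where C: "\<C> \<subseteq> \<V>" "closure R \<inter> V 0 = R \<union> \<Union>\<C>" "\<forall>R'\<in>\<C>. dm R' < dm R"
        using fr[of R] R unfolding Bd_def by blast
      have "F a \<notin> R" using R S part(2) by (auto simp: Bd_def disjoint_def)
      then obtain R' where R': "R' \<in> \<C>" "F a \<in> R'" using C(2) \<open>F a \<in> closure R\<close> \<open>F a \<in> V 0\<close> by blast
      then have "R' = S" using S C(1) part(2) by (auto simp: disjoint_def)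
      then show False using C(3) R' R by (auto simp: Bd_def)
    qed
    then have "\<forall>\<^sub>F z in nhds (F a). z \<in> N' \<and> (\<forall>R\<in>Bd. z \<in> - closure R)"
      using N' N(2) \<open>finite Bd\<close>
      by (intro eventually_conj eventually_ball_finite ballI eventually_nhds_in_open) auto
    then have near: "\<forall>\<^sub>F z in nhds (F a). z \<notin> S \<longrightarrow> avoids V z"
    proof eventually_elim
      case (elim z)
      show ?case
      proof (cases "z \<in> V 0")
        case True
        then obtain R where R: "R \<in> \<V>" "z \<in> R" using part(1) by blast
        show ?thesis
        proof (cases "R \<in> Bd")
          case True
          then show ?thesis using elim R(2) closure_subset by blast
        next
          case False
          then have "R = S \<or> CARD('n) \<le> dm R + 1" using R elim True N'(2) dS by (auto simp: Bd_def)
          then show ?thesis using big R by blast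
        qed
      next
        case False
        then show ?thesis using off by blast
      qed
    qed
    \<comment> \<open>\<open>local_unique_solution\<close> is applied to \<open>S\<close> in place
      of a nearby fibre. Since \<open>a\<close> itself is mapped into \<open>S\<close> at every
      time, it is the unique point of the small ball that is.\<close>
    have "\<forall>\<^sub>F p in nhds (t0, a). lin_homotopy F a (fst p) (snd p) \<in> S \<longrightarrow> snd p = a"
    proof -
      have "transversal_at (lin_homotopy F a t0) S a"
        using trS transversal_at_cong[of "lin_homotopy F a t0" a F]
        by (simp add: frechet_lin_homotopy[OF F] lin_homotopy_at[OF F])
      moreover have "lin_homotopy F a t0 a \<in> S" using S(2) by (simp add: lin_homotopy_at[OF F])
      ultimately have "\<exists>\<rho>0>0. \<forall>\<rho>. 0 < \<rho> \<and> \<rho> \<le> \<rho>0 \<longrightarrow>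
          (\<forall>\<^sub>F t in nhds t0. \<exists>!x. x \<in> cball a \<rho> \<and> lin_homotopy F a t x \<in> S)"
        using dS by (intro local_unique_solution[OF dm[OF S(1)] _ lin_homotopy_has_derivative[OF F]
            continuous_on_lin_homotopy[OF F] continuous_on_lin_homotopy'[OF F]]) simp_all
      then obtain \<rho> where \<rho>0: "\<rho> > 0" "\<forall>\<rho>'. 0 < \<rho>' \<and> \<rho>' \<le> \<rho> \<longrightarrow>
          (\<forall>\<^sub>F t in nhds t0. \<exists>!x. x \<in> cball a \<rho>' \<and> lin_homotopy F a t x \<in> S)"
        by (elim exE conjE) (rule that)
      have \<rho>: "\<rho> > 0" "\<forall>\<^sub>F t in nhds t0. \<exists>!x. x \<in> cball a \<rho> \<and> lin_homotopy F a t x \<in> S"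
        using \<rho>0(1) \<rho>0(2)[rule_format, of \<rho>] by simp_all
      have "\<forall>\<^sub>F x in nhds a. x \<in> cball a \<rho>"
        using eventually_nhds_in_nhd[of a "cball a \<rho>"] \<rho>(1) by simp
      with \<rho>(2) have "\<forall>\<^sub>F p in nhds t0 \<times>\<^sub>F nhds a. (\<exists>!x. x \<in> cball a \<rho> \<and> lin_homotopy F a (fst p) x \<in> S) \<and>
          snd p \<in> cball a \<rho>"
        by (intro eventually_conj eventually_compose_filterlim[OF _ filterlim_fst] eventually_compose_filterlim[OF _ filterlim_snd])
      then show ?thesis
        unfolding nhds_prod
      proof eventually_elim
        case (elim p)
        have "a \<in> cball a \<rho> \<and> lin_homotopy F a (fst p) a \<in> S" using S(2) \<rho>(1) by (simp add: lin_homotopy_at[OF F])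
        then show ?case using elim by blast
      qed
    qed
    moreover have "\<forall>\<^sub>F p in nhds (t0, a). lin_homotopy F a (fst p) (snd p) \<notin> S \<longrightarrow>
        avoids V (lin_homotopy F a (fst p) (snd p))"
      using near tend[of t0] by (auto simp: filterlim_iff)
    ultimately show ?thesis by eventually_elim blast
  qed
  then have "\<forall>\<^sub>F x in nhds a. \<forall>t\<in>{0..1}. snd (t, x) = a \<or> avoids V (lin_homotopy F a (fst (t, x)) (snd (t, x)))"
    by (intro eventually_compact compact_Icc) (simp only: nhds_prod)
  then show ?thesis by simp
qed

theorem proposition1:
  fixes P\<^sub>1 P\<^sub>2 :: "real ^ 'n \<Rightarrow> real"
    and V :: "real \<Rightarrow> (real ^ 'n) set"
    and \<V>\<^sub>0 :: "(real ^ 'n) set set"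
    and F :: "real ^ 2 \<Rightarrow> real ^ 'n"
    and a :: "real ^ 2"
    and k :: nat
  assumes "CARD('n) > 2"
    and "real_polynomial_function P\<^sub>1" and "real_polynomial_function P\<^sub>2"
    and V_def: "\<And>\<epsilon>. V \<epsilon> = {z. P\<^sub>1 z = \<epsilon> \<and> P\<^sub>2 z = 0}"
    and "\<forall>\<^sub>F \<epsilon> in at 0. smooth_submanifold (CARD('n) - 2) (V \<epsilon>)"
    and "stratification (V 0) \<V>\<^sub>0"
    and "\<forall>S\<in>\<V>\<^sub>0. semialgebraic S"
    and property_T:
      "\<And>(G :: real ^ 2 \<Rightarrow> real ^ 'n) b.
         Ck_on 2 UNIV G \<Longrightarrow> strat_transversal_at G \<V>\<^sub>0 b \<Longrightarrow>
         \<exists>U \<epsilon>\<^sub>0. open U \<and> b \<in> U \<and> \<epsilon>\<^sub>0 > 0 \<and>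
           (\<forall>\<epsilon>. 0 < \<bar>\<epsilon>\<bar> \<and> \<bar>\<epsilon>\<bar> < \<epsilon>\<^sub>0 \<longrightarrow> (\<forall>x\<in>U. transversal_at G (V \<epsilon>) x))"
    and "k > 2" and "Ck_on k UNIV F"
    and "\<forall>x. strat_transversal_at F \<V>\<^sub>0 x"
  shows "\<forall>\<^sub>F r in at_right 0. \<forall>\<^sub>F \<epsilon> in at 0.
           finite {x \<in> ball a r. (P\<^sub>1 (F x), P\<^sub>2 (F x)) = (\<epsilon>, 0)} \<and>
           finite {x \<in> ball a r.
             (P\<^sub>1 (linearization F a x), P\<^sub>2 (linearization F a x)) = (\<epsilon>, 0)} \<and>
           card {x \<in> ball a r. (P\<^sub>1 (F x), P\<^sub>2 (F x)) = (\<epsilon>, 0)} =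
           card {x \<in> ball a r.
             (P\<^sub>1 (linearization F a x), P\<^sub>2 (linearization F a x)) = (\<epsilon>, 0)}"
proof -
  have F: "Ck_on 2 UNIV F" using Ck_on_mono[OF assms(10)] assms(9) by simp
  have cP: "isCont P\<^sub>1 z" "isCont P\<^sub>2 z" for z
    using assms(2,3) continuous_real_polymonial_function by blast+
  have clV: "closed (V \<epsilon>)" for \<epsilon>
    unfolding V_def Collect_conj_eq
    by (intro closed_Int closed_Collect_eq continuous_on_const continuous_at_imp_continuous_on ballI cP)
  \<comment> \<open>Continuity of the polynomials: near \<open>z\<close> either
    \<open>P\<^sub>2\<close> does not vanish, or \<open>P\<^sub>1\<close> stays farther from 0 than
    any small level.\<close>
  have off: "avoids V z" if "z \<notin> V 0" for z
  proof (cases "P\<^sub>2 z = 0")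
    case True
    then have nz: "0 < \<bar>P\<^sub>1 z\<bar> / 2" using that by (auto simp: V_def)
    have "\<forall>\<^sub>F y in nhds z. dist (P\<^sub>1 y) (P\<^sub>1 z) < \<bar>P\<^sub>1 z\<bar> / 2"
      using isCont_tendsto_nhds[OF cP(1)] nz by (rule tendstoD)
    moreover have "\<forall>\<^sub>F \<epsilon> in at 0. \<bar>\<epsilon>\<bar> < \<bar>P\<^sub>1 z\<bar> / 2"
      using nz by (auto simp: eventually_at dist_real_def intro!: exI[of _ "\<bar>P\<^sub>1 z\<bar> / 2"])
    moreover have "y \<notin> V \<epsilon>" if "dist (P\<^sub>1 y) (P\<^sub>1 z) < \<bar>P\<^sub>1 z\<bar> / 2" "\<bar>\<epsilon>\<bar> < \<bar>P\<^sub>1 z\<bar> / 2" for y \<epsilon>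
    proof
      assume "y \<in> V \<epsilon>"
      then have "P\<^sub>1 y = \<epsilon>" by (simp add: V_def)
      then show False using that unfolding dist_real_def by linarith
    qed
    ultimately show ?thesis unfolding avoids_def eventually_prod_filter by (metis fst_conv snd_conv)
  next
    case False
    have "\<forall>\<^sub>F y in nhds z. P\<^sub>2 y \<noteq> 0"
      using isCont_tendsto_nhds[OF cP(2)] False by (rule tendsto_imp_eventually_ne)
    then show ?thesis
      unfolding avoids_def eventually_prod_filter V_def
      by (intro exI[of _ "\<lambda>y. P\<^sub>2 y \<noteq> 0"] exI[of _ "\<lambda>_. True"]) auto
  qed
  \<comment> \<open>\<open>F a\<close> can lie only in the fibre over
    \<open>P\<^sub>1 (F a)\<close>. This level is either nonzero, hence away from 0, or equal to 0
    and left out by \<open>at 0\<close>.\<close>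
  have disj: "\<forall>\<^sub>F \<epsilon> in at 0. F a \<notin> V \<epsilon>"
  proof -
    have "\<forall>\<^sub>F \<epsilon> in at 0. \<epsilon> \<noteq> P\<^sub>1 (F a)"
      using tendsto_imp_eventually_ne[OF tendsto_ident_at, of 0 "P\<^sub>1 (F a)" UNIV] eventually_neq_at_within[of 0 0]
      by (cases "P\<^sub>1 (F a) = 0") auto
    then show ?thesis by eventually_elim (auto simp: V_def)
  qed
  have tra: "strat_transversal_at F \<V>\<^sub>0 a" using assms(11) by blast
  let ?Q = "\<lambda>t x \<epsilon>. transversal_at (lin_homotopy F a t) (V \<epsilon>) x"
  have "\<forall>\<^sub>F y in nhds a \<times>\<^sub>F at 0. \<forall>t\<in>{0..1}. ?Q (fst (t, y)) (fst (snd (t, y))) (snd (snd (t, y)))"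
  proof (rule eventually_compact[OF compact_Icc])
    fix t0 :: real
    show "\<forall>\<^sub>F p in nhds t0 \<times>\<^sub>F (nhds a \<times>\<^sub>F at 0). ?Q (fst p) (fst (snd p)) (snd (snd p))"
      using homotopy_transversal[OF property_T disj F tra, of t0]
      unfolding nhds_prod by (simp add: prod_filter_assoc eventually_filtermap case_prod_beta')
  qed
  then obtain Px Pe where P: "eventually Px (nhds a)" "eventually Pe (at 0)"
    "\<And>x \<epsilon> t. Px x \<Longrightarrow> Pe \<epsilon> \<Longrightarrow> t \<in> {0..1} \<Longrightarrow> ?Q t x \<epsilon>"
    unfolding eventually_prod_filter by auto
  have "\<forall>\<^sub>F x in nhds a. Px x \<and> (\<forall>t\<in>{0..1}. x = a \<or> avoids V (lin_homotopy F a t x))"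
    using P(1) homotopy_avoids_punctured[OF property_T assms(1,5) off assms(6) F tra]
    by (rule eventually_conj)
  then obtain R where R: "R > 0" "\<And>x. dist x a < R \<Longrightarrow> Px x"
    "\<And>x t. dist x a < R \<Longrightarrow> t \<in> {0..1} \<Longrightarrow> x \<noteq> a \<Longrightarrow> avoids V (lin_homotopy F a t x)"
    unfolding eventually_nhds_metric by blast
  have "\<forall>\<^sub>F r in at_right 0. 0 < r \<and> r < R"
    using eventually_at_right_real[OF R(1)] by (auto elim: eventually_mono)
  then show ?thesis
  proof eventually_elim
    case (elim r)
    \<comment> \<open>Here \<epsilon> becomes dependent on \<open>r\<close>: the sphere misses
      \<open>a\<close>, so its images at all times avoid the fibres locally, and compactness of
      times and sphere gives a common threshold.\<close>
    have "\<forall>\<^sub>F \<epsilon> in at 0. \<forall>p\<in>{0..1} \<times> sphere a r.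
        lin_homotopy F a (fst (fst (p, \<epsilon>))) (snd (fst (p, \<epsilon>))) \<notin> V (snd (p, \<epsilon>))"
    proof (rule eventually_compact)
      show "compact ({0..1::real} \<times> sphere a r)" by (intro compact_Times compact_Icc compact_sphere)
      fix p assume p: "p \<in> {0..1::real} \<times> sphere a r"
      then have "avoids V (lin_homotopy F a (fst p) (snd p))"
        using R(3)[of "snd p" "fst p"] elim by (auto simp: dist_commute)
      moreover have "isCont (\<lambda>p. lin_homotopy F a (fst p) (snd p)) p"
        using continuous_on_lin_homotopy[OF F, of a] continuous_on_eq_continuous_at[OF open_UNIV]
        unfolding case_prod_beta' by blast
      then have "filterlim (\<lambda>q. (lin_homotopy F a (fst (fst q)) (snd (fst q)), snd q))
          (nhds (lin_homotopy F a (fst p) (snd p)) \<times>\<^sub>F at 0) (nhds p \<times>\<^sub>F at (0::real))"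
        by (intro filterlim_Pair filterlim_snd filterlim_compose[OF isCont_tendsto_nhds filterlim_fst])
      ultimately show "\<forall>\<^sub>F q in nhds p \<times>\<^sub>F at 0. lin_homotopy F a (fst (fst q)) (snd (fst q)) \<notin> V (snd q)"
        unfolding avoids_def by (auto simp: filterlim_iff)
    qed
    with P(2) assms(5) show ?case
    proof eventually_elim
      case (elim \<epsilon>)
      have n2: "DIM(real ^ 'n) = (CARD('n) - 2) + DIM(real ^ 2)" using assms(1) by simp
      have trn: "?Q t x \<epsilon>" if "t \<in> {0..1}" "x \<in> cball a r" for t x
        using P(3)[OF R(2) elim(1) that(1), of x] that(2) \<open>0 < r \<and> r < R\<close> by (auto simp: dist_commute)
      have bd: "lin_homotopy F a t x \<notin> V \<epsilon>" if "t \<in> {0..1}" "x \<in> sphere a r" for t x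
        using elim(3) that by auto
      note sol = solutions_card_const[OF elim(2) n2 clV lin_homotopy_has_derivative[OF F]
          continuous_on_lin_homotopy[OF F] continuous_on_lin_homotopy'[OF F] trn bd]
      show ?case using sol by (simp add: lin_homotopy_01 V_def)
    qed
  qed
qed

end
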